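(* Let $\mu$ be a non-zero, finite, compactly supported Borel measure on $\mathbb{R}^d$. If $$q>\inf\Big\{\frac4\theta:\ \theta\in[0,1],\ \dim^\theta_{\mathrm F}\mu>d\theta\Big\},$$ then for all $f\in L^2(\mu)$, $$\|\widehat{f\mu}\|_{L^q(\mathbb{R}^d)}\lesssim\|f\|_{L^2(\mu)}.$$ Equivalently, if $$1\leq q'<\sup\Big\{\frac4{4-\theta}:\ \theta\in[0,1],\ \dim^\theta_{\mathrm F}\mu>d\theta\Big\},$$ then for all $f\in L^{q'}(\mathbb{R}^d)$, $$\|\widehat f\|_{L^2(\mu)}\lesssim\|f\|_{L^{q'}(\mathbb{R}^d)}.$$
   Context: $A\lesssim B$ means $A\leq CB$ with a constant $C>0$ independent of $f$. $q'$ is the conjugate exponent of $q$. Fourier transforms: $\widehat f(\xi)=\int_{\mathbb{R}^d}e^{-2\pi i\xi\cdot x}f(x)\,dx$, $\widehat\mu(\xi)=\int e^{-2\pi i\xi\cdot x}\,d\mu(x)$, $\widehat{f\mu}(\xi)=\int e^{-2\pi i\xi\cdot x}f(x)\,d\mu(x)$. The estimate for $\|\widehat f\|_{L^2(\mu)}$ is understood as an estimate for Schwartz functions $f$, extended by density. Fourier spectrum: for $\theta\in(0,1]$ let $\mathcal{J}_{s,\theta}(\mu)=\Big(\int_{\mathbb{R}^d}|\widehat\mu(\xi)|^{2/\theta}|\xi|^{s/\theta-d}\,d\xi\Big)^\theta$ and for $\theta=0$ let $\mathcal{J}_{s,0}(\mu)=\sup_{\xi\in\mathbb{R}^d}|\widehat\mu(\xi)|^2|\xi|^s$.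 Then $\dim^\theta_{\mathrm F}\mu=\sup\{s\in\mathbb{R}:\mathcal{J}_{s,\theta}(\mu)<\infty\}$ (with value $0$ if the set is empty). Conventions: $4/0=\infty$; if no $\theta\in[0,1]$ is admissible, the statement is vacuous. *)

theory Defs
  imports "HOL-Probability.Essential_Supremum"
begin

definition measure_support :: "'a::topological_space measure \<Rightarrow> 'a set" where
  "measure_support M = {x. \<forall>U. open U \<and> x \<in> U \<longrightarrow> emeasure M U \<noteq> 0}"

(* fourier lborel f, fourier \<mu> (\<lambda>_. 1) and fourier \<mu> f are the transforms of
   the function f, of the measure \<mu>, and of the measure f\<mu>, respectively. *)
definition fourier :: "'a::euclidean_space measure \<Rightarrow> ('a \<Rightarrow> complex) \<Rightarrow> 'a \<Rightarrow> complex" where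
  "fourier M f \<xi> =
     (\<integral>x. exp (- 2 * complex_of_real pi * \<i> * complex_of_real (\<xi> \<bullet> x)) * f x \<partial>M)"

(* Real powers on [0,\<infinity>]; only used with exponent a > 0. *)
definition epowr :: "ennreal \<Rightarrow> real \<Rightarrow> ennreal" where
  "epowr x a = (if x = \<infinity> then \<infinity> else ennreal (enn2real x powr a))"

(* Only meaningful for exponents 1 \<le> p \<le> \<infinity>. *)
definition Lp_norm :: "ereal \<Rightarrow> 'a measure \<Rightarrow> ('a \<Rightarrow> complex) \<Rightarrow> ennreal" where
  "Lp_norm p M f =
     (if p = \<infinity> then esssup M (\<lambda>x. ennreal (norm (f x)))
      else epowr (\<integral>\<^sup>+x. ennreal (norm (f x) powr real_of_ereal p) \<partial>M) (1 / real_of_ereal p))"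

definition Lp_space :: "ereal \<Rightarrow> 'a measure \<Rightarrow> ('a \<Rightarrow> complex) set" where
  "Lp_space p M = {f \<in> borel_measurable M. Lp_norm p M f < \<infinity>}"

(* In HOL, 0 powr s = 0 for every s. This does not affect the values below when \<mu> is finite and
   non-zero: the origin is a null set for the integral, and, the transform of \<mu> being continuous
   and non-zero at 0, punctured neighbourhoods of 0 already give the supremum its usual value
   (in particular \<infinity> for s < 0). *)
definition fourier_energy :: "real \<Rightarrow> real \<Rightarrow> 'a::euclidean_space measure \<Rightarrow> ennreal" where
  "fourier_energy s \<theta> \<mu> =
     (if \<theta> = 0
      then (SUP \<xi>. ennreal ((norm (fourier \<mu> (\<lambda>_. 1) \<xi>))\<^sup>2 * norm \<xi> powr s))
      else epowr (\<integral>\<^sup>+\<xi>. ennreal (norm (fourier \<mu> (\<lambda>_. 1) \<xi>) powr (2 / \<theta>)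
                                * norm \<xi> powr (s / \<theta> - real DIM('a))) \<partial>lborel) \<theta>)"

definition fourier_dim :: "real \<Rightarrow> 'a::euclidean_space measure \<Rightarrow> ereal" where
  "fourier_dim \<theta> \<mu> =
     (let S = {s. fourier_energy s \<theta> \<mu> < \<infinity>} in if S = {} then 0 else Sup (ereal ` S))"

definition admissible :: "'a::euclidean_space measure \<Rightarrow> real set" where
  "admissible \<mu> = {\<theta> \<in> {0..1}. fourier_dim \<theta> \<mu> > ereal (real DIM('a) * \<theta>)}"

primrec iterated_partial ::
  "'a::euclidean_space list \<Rightarrow> ('a \<Rightarrow> complex) \<Rightarrow> 'a \<Rightarrow> complex" where
  "iterated_partial [] f = f"
| "iterated_partial (b # bs) f = (\<lambda>x. frechet_derivative (iterated_partial bs f) (at x) b)"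

(* Differentiability of all iterated partial derivatives is C^\<infinity> smoothness. *)
definition schwartz :: "('a::euclidean_space \<Rightarrow> complex) \<Rightarrow> bool" where
  "schwartz f \<longleftrightarrow>
     (\<forall>bs. set bs \<subseteq> Basis \<longrightarrow>
        (\<forall>x. iterated_partial bs f differentiable (at x)) \<and>
        (\<forall>k::nat. bounded (range (\<lambda>x. (1 + norm x) ^ k *\<^sub>R iterated_partial bs f x))))"

(* g represents the transform of f in L^2(\<mu>), defined by density of the Schwartz functions
   in L^p. *)
definition fourier_extension ::
  "'a::euclidean_space measure \<Rightarrow> ereal \<Rightarrow> ('a \<Rightarrow> complex) \<Rightarrow> ('a \<Rightarrow> complex) \<Rightarrow> bool" where
  "fourier_extension \<mu> p f g \<longleftrightarrow>
     g \<in> Lp_space 2 \<mu> \<and>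
     (\<exists>F. (\<forall>n::nat. schwartz (F n)) \<and>
          (\<lambda>n. Lp_norm p lborel (\<lambda>x. F n x - f x)) \<longlonglongrightarrow> 0 \<and>
          (\<lambda>n. Lp_norm 2 \<mu> (\<lambda>\<xi>. fourier lborel (F n) \<xi> - g \<xi>)) \<longlonglongrightarrow> 0)"

end

(* If dim_F^theta mu > d theta for some theta > 0, then the weight |xi|^(s/theta - d) in the energy is
   at least 1 off the unit ball, so the transform m of mu lies in L^(2/theta), hence, being bounded,
   in L^r for all r >= 2/theta. Since the integral of |h^|^2 with respect to mu is the double integral
   of h(x) conj(h(y)) m(y - x), Young's inequality with 2/p + 1/r = 2 bounds it by a multiple of
   |h|_p^2; no interpolation is needed. Testing against h = conj(u) |u|^(q-2) on balls, where u is the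
   transform of f mu, turns this into the dual extension estimate. The restriction estimate passes to all
   of L^p because indicators of boxes are dominated limits of super-Gaussians, so Schwartz functions
   are dense, and because L^2(mu) is complete. *)
theory Submission
  imports Defs
begin

text \<open>Both thresholds come from one exponent relation: \<open>2 / p + 1 / r = 2\<close> turns
  \<open>r = 2 / \<theta>\<close> into \<open>p = 4 / (4 - \<theta>)\<close>, whose conjugate
  exponent is \<open>4 / \<theta>\<close>. Only \<open>\<theta> > 0\<close> can witness a
  hypothesis, since at \<open>\<theta> = 0\<close> the thresholds are \<open>p < 1\<close> and
  \<open>q > \<infinity>\<close>. The end points \<open>p = 1\<close> (where \<open>r\<close> would
  be infinite) and \<open>q = \<infinity>\<close> lie outside the Young argument and rest on the
  finite mass of \<open>\<mu>\<close> alone. The central bound is proved for all integrable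
  \<open>h\<close>, not just for Schwartz functions: the test function of the duality argument is
  cut off at a sphere and hence not smooth, while Schwartz functions are covered as a special case.
  The cut-off is there because the norm to be estimated is not yet known to be finite; on a ball it
  is, so a power of it can be cancelled. Density and completeness enter only for the second half,
  where the transform of a general \<open>f\<close> in \<open>L^p\<close> has to exist as an element
  of \<open>L^2(\<mu>)\<close> before it can be estimated.\<close>

section \<open>The transform of a function with respect to a measure, and the multiplication
  formula\<close>

lemma norm_fourier_kernel [simp]:
  "norm (exp (- (2 * complex_of_real pi * \<i> * complex_of_real t))) = 1"
  by (simp add: norm_exp_eq_Re)

lemma norm_fourier_le: "norm (fourier M f \<xi>) \<le> (\<integral>x. norm (f x) \<partial>M)"
  unfolding fourier_def using integral_norm_bound[of M "\<lambda>x. exp (- 2 * complex_of_real pi * \<i> * complex_of_real (\<xi> \<bullet> x)) * f x"]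
  by (simp add: norm_mult)

lemma integrable_fourier_kernel:
  fixes \<xi> :: "'a::euclidean_space"
  assumes "sets M = sets borel" "integrable M f"
  shows "integrable M (\<lambda>x. exp (- 2 * complex_of_real pi * \<i> * complex_of_real (\<xi> \<bullet> x)) * f x)"
proof (rule Bochner_Integration.integrable_bound[OF assms(2)])
  note assms(1)[measurable_cong]
  have [measurable]: "f \<in> borel_measurable M" using assms(2) by auto
  show "(\<lambda>x. exp (- 2 * complex_of_real pi * \<i> * complex_of_real (\<xi> \<bullet> x)) * f x) \<in> borel_measurable M"
    by measurable
qed (simp add: norm_mult)

lemma borel_measurable_fourier:
  assumes "sigma_finite_measure M" "sets M = sets borel" "f \<in> borel_measurable M"
  shows "fourier M f \<in> borel_measurable borel"
proof -
  interpret sigma_finite_measure M by fact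
  note assms(2)[measurable_cong] assms(3)[measurable]
  show ?thesis
    unfolding fourier_def by measurable
qed

lemma fourier_diff:
  assumes "sets M = sets borel" "integrable M f" "integrable M g"
  shows "fourier M (\<lambda>x. f x - g x) \<xi> = fourier M f \<xi> - fourier M g \<xi>"
  unfolding fourier_def right_diff_distrib
  by (rule Bochner_Integration.integral_diff; rule integrable_fourier_kernel[OF assms(1)]; fact)

text \<open>Fubini: the kernel has modulus 1, so integrability of the tensor product of
  \<open>u\<close> and \<open>v\<close> suffices, and it is symmetric in \<open>x\<close> and
  \<open>\<xi>\<close>, so the inner integral is again a transform. Two different measures are
  allowed because it is applied with \<open>lborel\<close> on one side and \<open>\<mu>\<close> on
  the other.\<close>

lemma fourier_multiplication:
  fixes u v :: "'a::euclidean_space \<Rightarrow> complex"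
  assumes "sigma_finite_measure M" "sets M = sets borel" "integrable M u"
    and "sigma_finite_measure N" "sets N = sets borel" "integrable N v"
  shows "(\<integral>\<xi>. fourier M u \<xi> * v \<xi> \<partial>N) = (\<integral>x. u x * fourier N v x \<partial>M)"
proof -
  interpret M: sigma_finite_measure M by fact
  interpret N: sigma_finite_measure N by fact
  interpret pair_sigma_finite M N ..
  note [measurable_cong] = assms(2,5)
  have [measurable]: "u \<in> borel_measurable M" "v \<in> borel_measurable N"
    using assms(3,6) by auto
  define e where "e = (\<lambda>x \<xi> :: 'a. exp (- 2 * complex_of_real pi * \<i> * complex_of_real (\<xi> \<bullet> x)))"
  have [simp]: "norm (e x \<xi>) = 1" for x \<xi> by (simp add: e_def)
  have e_sym: "e x \<xi> = e \<xi> x" for x \<xi> by (simp add: e_def inner_commute)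
  have [measurable]: "case_prod e \<in> borel_measurable (M \<Otimes>\<^sub>M N)"
    unfolding e_def by measurable
  have "integrable (M \<Otimes>\<^sub>M N) (\<lambda>(x, \<xi>). u x * v \<xi>)"
  proof (rule Fubini_integrable)
    show "integrable M (\<lambda>x. \<integral>y. norm (case (x, y) of (x, \<xi>) \<Rightarrow> u x * v \<xi>) \<partial>N)"
      using assms(3) by (simp add: norm_mult)
  qed (use assms(6) in simp_all)
  then have int: "integrable (M \<Otimes>\<^sub>M N) (\<lambda>(x, \<xi>). e x \<xi> * u x * v \<xi>)"
  proof (rule Bochner_Integration.integrable_bound)
    show "(\<lambda>(x, \<xi>). e x \<xi> * u x * v \<xi>) \<in> borel_measurable (M \<Otimes>\<^sub>M N)" by measurable
  qed (simp add: norm_mult split_beta)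
  have "(\<integral>\<xi>. fourier M u \<xi> * v \<xi> \<partial>N) = (\<integral>\<xi>. (\<integral>x. e x \<xi> * u x * v \<xi> \<partial>M) \<partial>N)"
    unfolding fourier_def e_def by simp
  also have "\<dots> = (\<integral>x. (\<integral>\<xi>. e x \<xi> * u x * v \<xi> \<partial>N) \<partial>M)"
    using Fubini_integral[OF int] by simp
  also have "\<dots> = (\<integral>x. (\<integral>\<xi>. u x * (e \<xi> x * v \<xi>) \<partial>N) \<partial>M)"
    by (simp add: e_sym mult_ac)
  also have "\<dots> = (\<integral>x. u x * fourier N v x \<partial>M)"
    unfolding fourier_def e_def by simp
  finally show ?thesis .
qed

section \<open>A trilinear Young inequality\<close>

text \<open>A crude weighted AM-GM inequality: each factor is at most the corresponding power of
  \<open>x + y + z\<close>, and the exponents add up to 1.\<close>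

lemma powr_mult_le_sum:
  fixes x y z :: real
  assumes "x \<ge> 0" "y \<ge> 0" "z \<ge> 0" "a \<ge> 0" "b \<ge> 0" "c \<ge> 0" "a + b + c = 1"
  shows "x powr a * y powr b * z powr c \<le> x + y + z"
proof -
  let ?S = "x + y + z"
  have "x powr a * y powr b * z powr c \<le> ?S powr a * ?S powr b * ?S powr c"
    using assms by (intro mult_mono powr_mono2 mult_nonneg_nonneg) auto
  also have "\<dots> = ?S powr (a + b + c)" by (simp add: powr_add)
  also have "\<dots> = ?S" using assms by simp
  finally show ?thesis .
qed

text \<open>Write \<open>s * t * m\<close> as the product of \<open>s^p t^p\<close>,
  \<open>s^p m^r\<close> and \<open>t^p m^r\<close> to the powers \<open>1 - 2 b\<close>,
  \<open>b\<close>, \<open>b\<close>, with \<open>b = 1 / (2 r)\<close>. Then \<open>m\<close> has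
  exponent \<open>2 r b = 1\<close>, and \<open>s\<close> and \<open>t\<close> have exponent
  \<open>p (1 - b)\<close>, which is 1 exactly by the relation between \<open>p\<close> and
  \<open>r\<close>. Each product contains only two of the three factors, so its double integral will
  split into single integrals.\<close>

lemma young_pointwise:
  fixes s t m p r :: real
  assumes "s \<ge> 0" "t \<ge> 0" "m \<ge> 0" "r \<ge> 1" "p > 0" "2 / p + 1 / r = 2"
  shows "s * t * m \<le> s powr p * t powr p + s powr p * m powr r + t powr p * m powr r"
proof (cases "s = 0 \<or> t = 0 \<or> m = 0")
  case False
  then have pos: "s > 0" "t > 0" "m > 0" using assms by auto
  define b where "b = 1 / (2 * r)"
  have b: "0 \<le> b" "b \<le> 1/2" "r * b + r * b = 1" using assms(4) by (auto simp: b_def field_simps)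
  have "p * (1 - b) = 1" using assms(4-6) by (simp add: b_def field_simps)
  then have e: "p * (1 - 2 * b) + p * b = 1" by (simp add: algebra_simps)
  have "(s powr p * t powr p) powr (1 - 2 * b) * (s powr p * m powr r) powr b * (t powr p * m powr r) powr b
     = s powr (p * (1 - 2 * b) + p * b) * t powr (p * (1 - 2 * b) + p * b) * m powr (r * b + r * b)"
    by (simp only: powr_mult powr_powr powr_add mult_ac)
  also have "\<dots> = s * t * m" using pos by (simp add: e b)
  finally show ?thesis
    using powr_mult_le_sum[of "s powr p * t powr p" "s powr p * m powr r" "t powr p * m powr r" "1 - 2*b" b b]
      b by simp
qed auto

lemma nn_integral_lborel_reflect_translate:
  fixes f :: "'a::euclidean_space \<Rightarrow> ennreal"
  assumes [measurable]: "f \<in> borel_measurable borel"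
  shows "(\<integral>\<^sup>+x. f (y - x) \<partial>lborel) = (\<integral>\<^sup>+x. f x \<partial>lborel)"
proof -
  have "(\<integral>\<^sup>+x. f x \<partial>lborel) = (\<integral>\<^sup>+x. f x \<partial>distr lborel borel (\<lambda>x. y + (-1) *\<^sub>R x))"
    using lborel_affine[of "-1" y] by (simp add: density_1)
  also have "\<dots> = (\<integral>\<^sup>+x. f (y - x) \<partial>lborel)"
    by (subst nn_integral_distr) auto
  finally show ?thesis by simp
qed

lemma nn_integral_lborel_translate:
  fixes f :: "'a::euclidean_space \<Rightarrow> ennreal"
  assumes [measurable]: "f \<in> borel_measurable borel"
  shows "(\<integral>\<^sup>+x. f (x - y) \<partial>lborel) = (\<integral>\<^sup>+x. f x \<partial>lborel)"
proof -
  have "(\<integral>\<^sup>+x. f x \<partial>lborel) = (\<integral>\<^sup>+x. f x \<partial>distr lborel borel ((+) (- y)))"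
    by (simp add: lborel_distr_plus)
  also have "\<dots> = (\<integral>\<^sup>+x. f (x - y) \<partial>lborel)"
    by (subst nn_integral_distr) auto
  finally show ?thesis by simp
qed

text \<open>With \<open>f\<close> normalized, the three terms of the pointwise inequality integrate
  to 1, \<open>K\<close> and \<open>K\<close>, by translation and reflection invariance of
  \<open>lborel\<close>. The inequality is not homogeneous in \<open>f\<close>; the general case is
  recovered by scaling in \<open>Lp_norm_fourier_le\<close>.\<close>

lemma young_bound_normalized:
  fixes f m :: "'a::euclidean_space \<Rightarrow> real"
  assumes [measurable]: "f \<in> borel_measurable borel" "m \<in> borel_measurable borel"
    and nonneg: "\<And>x. f x \<ge> 0" "\<And>x. m x \<ge> 0"
    and exps: "r \<ge> 1" "p > 0" "2 / p + 1 / r = 2"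
    and f: "(\<integral>\<^sup>+x. ennreal (f x powr p) \<partial>lborel) = 1"
    and m: "(\<integral>\<^sup>+x. ennreal (m x powr r) \<partial>lborel) = K"
  shows "(\<integral>\<^sup>+x. \<integral>\<^sup>+y. ennreal (f x * f y * m (y - x)) \<partial>lborel \<partial>lborel) \<le> 1 + 2 * K"
proof -
  let ?F = "\<lambda>x. ennreal (f x powr p)" and ?M = "\<lambda>x. ennreal (m x powr r)"
  have "(\<integral>\<^sup>+x. \<integral>\<^sup>+y. ennreal (f x * f y * m (y - x)) \<partial>lborel \<partial>lborel)
      \<le> (\<integral>\<^sup>+x. \<integral>\<^sup>+y. ?F x * ?F y + ?F x * ?M (y - x) + ?F y * ?M (y - x) \<partial>lborel \<partial>lborel)"
  proof (intro nn_integral_mono)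
    fix x y
    have "?F x * ?F y + ?F x * ?M (y - x) + ?F y * ?M (y - x) =
      ennreal (f x powr p * f y powr p + f x powr p * m (y - x) powr r + f y powr p * m (y - x) powr r)"
      by (simp add: ennreal_mult)
    then show "ennreal (f x * f y * m (y - x)) \<le> ?F x * ?F y + ?F x * ?M (y - x) + ?F y * ?M (y - x)"
      using young_pointwise[OF nonneg(1)[of x] nonneg(1)[of y] nonneg(2)[of "y - x"] exps]
      by (simp only: ennreal_leI)
  qed
  also have "\<dots> = (\<integral>\<^sup>+x. \<integral>\<^sup>+y. ?F x * ?F y \<partial>lborel \<partial>lborel) + (\<integral>\<^sup>+x. \<integral>\<^sup>+y. ?F x * ?M (y - x) \<partial>lborel \<partial>lborel)
      + (\<integral>\<^sup>+x. \<integral>\<^sup>+y. ?F y * ?M (y - x) \<partial>lborel \<partial>lborel)"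
    by (simp add: nn_integral_add)
  also have "(\<integral>\<^sup>+x. \<integral>\<^sup>+y. ?F y * ?M (y - x) \<partial>lborel \<partial>lborel) = (\<integral>\<^sup>+y. \<integral>\<^sup>+x. ?F y * ?M (y - x) \<partial>lborel \<partial>lborel)"
    by (rule lborel_pair.Fubini') measurable
  also have "\<dots> = K"
    by (simp add: nn_integral_cmult nn_integral_lborel_reflect_translate[where f = ?M] m nn_integral_multc f)
  also have "(\<integral>\<^sup>+x. \<integral>\<^sup>+y. ?F x * ?M (y - x) \<partial>lborel \<partial>lborel) = K"
    by (simp add: nn_integral_cmult nn_integral_lborel_translate[where f = ?M] m nn_integral_multc f)
  also have "(\<integral>\<^sup>+x. \<integral>\<^sup>+y. ?F x * ?F y \<partial>lborel \<partial>lborel) = 1"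
    by (simp add: nn_integral_cmult nn_integral_multc f)
  finally show ?thesis by (simp add: mult_2 add.assoc)
qed

text \<open>No integrability is assumed: otherwise the Bochner integral is 0 by convention and the
  bound is trivial.\<close>

lemma norm_integral_le_nn_integral:
  fixes f :: "'a \<Rightarrow> 'b::{banach, second_countable_topology}"
  shows "ennreal (norm (\<integral>x. f x \<partial>M)) \<le> (\<integral>\<^sup>+x. ennreal (norm (f x)) \<partial>M)"
  by (cases "integrable M f") (simp_all add: integral_norm_bound_ennreal not_integrable_integral_eq)

text \<open>With \<open>H\<close> the transform of \<open>h\<close>, the multiplication formula is
  applied twice: once to move the outer \<open>h\<close> off \<open>H * cnj H\<close>, and once more
  to evaluate the transform of \<open>cnj H\<close> times \<open>\<mu>\<close>. The right-hand side
  is a nonnegative integral, so it may be infinite and the double integral needs no absolute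
  convergence.\<close>

lemma nn_integral_fourier_square_le:
  fixes \<mu> :: "'a::euclidean_space measure" and h :: "'a \<Rightarrow> complex"
  assumes sets: "sets \<mu> = sets borel" and "finite_measure \<mu>" and h: "integrable lborel h"
  shows "(\<integral>\<^sup>+\<xi>. ennreal ((norm (fourier lborel h \<xi>))\<^sup>2) \<partial>\<mu>)
    \<le> (\<integral>\<^sup>+x. \<integral>\<^sup>+y. ennreal (norm (h x) * norm (h y) * norm (fourier \<mu> (\<lambda>_. 1) (y - x))) \<partial>lborel \<partial>lborel)"
proof -
  interpret finite_measure \<mu> by fact
  note sets[measurable_cong]
  have [measurable]: "h \<in> borel_measurable borel" using borel_measurable_integrable[OF h] by simp
  define H where "H = fourier lborel h"
  have [measurable]: "H \<in> borel_measurable borel"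
    unfolding H_def by (rule borel_measurable_fourier) (auto intro: sigma_finite_lborel)
  have [measurable]: "(\<lambda>\<xi>. cnj (H \<xi>)) \<in> borel_measurable borel"
    by (rule measurable_compose[OF _ borel_measurable_continuous_onI])
      (auto intro!: continuous_intros)
  have H_bound: "norm (H \<xi>) \<le> (\<integral>x. norm (h x) \<partial>lborel)" for \<xi>
    unfolding H_def by (rule norm_fourier_le)
  have intH: "integrable \<mu> (\<lambda>\<xi>. cnj (H \<xi>))"
    by (rule integrable_const_bound[where B = "\<integral>x. norm (h x) \<partial>lborel"]) (use H_bound in auto)
  have intH2: "integrable \<mu> (\<lambda>\<xi>. (norm (H \<xi>))\<^sup>2)"
    by (rule integrable_const_bound[where B = "(\<integral>x. norm (h x) \<partial>lborel)\<^sup>2"])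
      (use H_bound in \<open>auto intro!: power_mono\<close>)
  have swap: "norm (fourier \<mu> (\<lambda>\<xi>. cnj (H \<xi>)) x)
      \<le> (\<integral>\<^sup>+y. ennreal (norm (h y) * norm (fourier \<mu> (\<lambda>_. 1) (y - x))) \<partial>lborel)" for x
  proof -
    \<comment> \<open>\<open>w\<close> is the conjugate of the kernel at frequency \<open>x\<close>.
      Its transform with respect to \<open>\<mu>\<close> is that of \<open>\<mu>\<close> itself,
      translated by \<open>x\<close>; this produces the argument \<open>y - x\<close>.\<close>
    define w where "w = (\<lambda>\<xi>. exp (2 * complex_of_real pi * \<i> * complex_of_real (x \<bullet> \<xi>)))"
    have [measurable]: "w \<in> borel_measurable borel" unfolding w_def by measurable
    have "norm (w \<xi>) = 1" for \<xi> by (simp add: w_def norm_exp_eq_Re)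
    then have w: "integrable \<mu> w"
      by (intro integrable_const_bound[where B = 1]) auto
    have "cnj (fourier \<mu> (\<lambda>\<xi>. cnj (H \<xi>)) x) = (\<integral>\<xi>. cnj (exp (- 2 * complex_of_real pi * \<i> * complex_of_real (x \<bullet> \<xi>)) * cnj (H \<xi>)) \<partial>\<mu>)"
      unfolding fourier_def by (simp only: Bochner_Integration.integral_cnj)
    also have "\<dots> = (\<integral>\<xi>. H \<xi> * w \<xi> \<partial>\<mu>)"
      by (rule Bochner_Integration.integral_cong) (simp_all add: w_def exp_cnj mult.commute)
    also have "\<dots> = (\<integral>y. h y * fourier \<mu> w y \<partial>lborel)"
      unfolding H_def by (rule fourier_multiplication)
        (use sets h w sigma_finite_measure_axioms in \<open>auto intro: sigma_finite_lborel\<close>)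
    also have "fourier \<mu> w = (\<lambda>y. fourier \<mu> (\<lambda>_. 1) (y - x))"
      unfolding fourier_def w_def
      by (auto simp: exp_add[symmetric] algebra_simps inner_diff_left intro!: ext Bochner_Integration.integral_cong)
    finally have "norm (fourier \<mu> (\<lambda>\<xi>. cnj (H \<xi>)) x) = norm (\<integral>y. h y * fourier \<mu> (\<lambda>_. 1) (y - x) \<partial>lborel)"
      by (metis complex_mod_cnj)
    then show ?thesis
      using norm_integral_le_nn_integral[of lborel "\<lambda>y. h y * fourier \<mu> (\<lambda>_. 1) (y - x)"]
      by (simp add: norm_mult)
  qed
  have "complex_of_real (\<integral>\<xi>. (norm (H \<xi>))\<^sup>2 \<partial>\<mu>) = (\<integral>\<xi>. H \<xi> * cnj (H \<xi>) \<partial>\<mu>)"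
    unfolding integral_complex_of_real[symmetric] complex_norm_square[symmetric] by simp
  also have "\<dots> = (\<integral>x. h x * fourier \<mu> (\<lambda>\<xi>. cnj (H \<xi>)) x \<partial>lborel)"
    unfolding H_def[abs_def] by (rule fourier_multiplication)
      (use sets h intH sigma_finite_measure_axioms in \<open>auto simp: H_def intro: sigma_finite_lborel\<close>)
  finally have eq: "complex_of_real (\<integral>\<xi>. (norm (H \<xi>))\<^sup>2 \<partial>\<mu>) = \<dots>" .
  have "(\<integral>\<^sup>+\<xi>. ennreal ((norm (H \<xi>))\<^sup>2) \<partial>\<mu>) = ennreal (\<integral>\<xi>. (norm (H \<xi>))\<^sup>2 \<partial>\<mu>)"
    by (rule nn_integral_eq_integral[OF intH2]) simp
  also have "(\<integral>\<xi>. (norm (H \<xi>))\<^sup>2 \<partial>\<mu>) = norm (\<integral>x. h x * fourier \<mu> (\<lambda>\<xi>. cnj (H \<xi>)) x \<partial>lborel)"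
    unfolding eq[symmetric] by simp
  also have "ennreal \<dots> \<le> (\<integral>\<^sup>+x. ennreal (norm (h x)) * ennreal (norm (fourier \<mu> (\<lambda>\<xi>. cnj (H \<xi>)) x)) \<partial>lborel)"
    using norm_integral_le_nn_integral[of lborel "\<lambda>x. h x * fourier \<mu> (\<lambda>\<xi>. cnj (H \<xi>)) x"]
    by (simp add: norm_mult ennreal_mult)
  also have "\<dots> \<le> (\<integral>\<^sup>+x. ennreal (norm (h x)) * (\<integral>\<^sup>+y. ennreal (norm (h y) * norm (fourier \<mu> (\<lambda>_. 1) (y - x))) \<partial>lborel) \<partial>lborel)"
    by (intro nn_integral_mono mult_left_mono swap) simp
  also have "\<dots> = (\<integral>\<^sup>+x. \<integral>\<^sup>+y. ennreal (norm (h x) * norm (h y) * norm (fourier \<mu> (\<lambda>_. 1) (y - x))) \<partial>lborel \<partial>lborel)"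
  proof -
    have [measurable]: "fourier \<mu> (\<lambda>_. 1) \<in> borel_measurable borel"
      by (rule borel_measurable_fourier) (use sets sigma_finite_measure_axioms in auto)
    show ?thesis
      by (intro nn_integral_cong) (simp add: nn_integral_cmult[symmetric] ennreal_mult[symmetric] mult.assoc)
  qed
  finally show ?thesis by (simp add: H_def)
qed

section \<open>Powers on the extended half-line and \<open>L^p\<close> norms\<close>

lemma epowr_ennreal [simp]: "x \<ge> 0 \<Longrightarrow> epowr (ennreal x) a = ennreal (x powr a)"
  by (simp add: epowr_def)

lemma epowr_0 [simp]: "epowr 0 a = 0"
  by (simp add: epowr_def)

lemma epowr_1 [simp]: "epowr 1 a = 1"
  by (simp add: epowr_def)

lemma epowr_one [simp]: "epowr x 1 = x"
  by (cases x) (simp_all add: epowr_def)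

lemma epowr_mono: "x \<le> y \<Longrightarrow> a \<ge> 0 \<Longrightarrow> epowr x a \<le> epowr y a"
  by (cases x; cases y) (auto simp: epowr_def top_unique intro!: ennreal_leI powr_mono2)

lemma epowr_mult:
  assumes "a > 0"
  shows "epowr (x * y) a = epowr x a * epowr y a"
proof (cases "x = 0 \<or> y = 0")
  case False
  then show ?thesis
    by (cases x; cases y)
      (auto simp: epowr_def powr_mult ennreal_mult[symmetric] ennreal_mult_top ennreal_top_mult)
qed (use assms in auto)

lemma epowr_epowr: "epowr (epowr x a) b = epowr x (a * b)"
  by (cases x) (auto simp: epowr_def powr_powr)

lemma epowr_less_top_iff: "epowr x a < \<infinity> \<longleftrightarrow> x < \<infinity>"
  by (cases x) (auto simp: epowr_def)

lemma epowr_eq_0_iff: "epowr x a = 0 \<longleftrightarrow> x = 0"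
  by (cases x) (auto simp: epowr_def ennreal_eq_0_iff)

lemma Lp_norm_ereal: "Lp_norm (ereal p) M f = epowr (\<integral>\<^sup>+x. ennreal (norm (f x) powr p) \<partial>M) (1 / p)"
  by (simp add: Lp_norm_def)

lemma Lp_norm_2: "Lp_norm 2 M f = epowr (\<integral>\<^sup>+x. ennreal ((norm (f x))\<^sup>2) \<partial>M) (1 / 2)"
  using Lp_norm_ereal[of 2 M f] by simp

lemma Lp_norm_cmult:
  assumes "p > 0" "f \<in> borel_measurable M"
  shows "Lp_norm (ereal p) M (\<lambda>x. c * f x) = ennreal (norm c) * Lp_norm (ereal p) M f"
  using assms
  by (simp add: Lp_norm_ereal norm_mult powr_mult ennreal_mult nn_integral_cmult epowr_mult powr_powr)

lemma Lp_norm_eq_0_AE: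
  assumes "p > 0" "f \<in> borel_measurable M" "Lp_norm (ereal p) M f = 0"
  shows "AE x in M. f x = 0"
  using assms by (auto simp: Lp_norm_ereal epowr_eq_0_iff nn_integral_0_iff_AE elim!: eventually_mono)

lemma fourier_cmult: "fourier M (\<lambda>x. c * f x) \<xi> = c * fourier M f \<xi>"
proof -
  have "fourier M (\<lambda>x. c * f x) \<xi> = (\<integral>x. c * (exp (- 2 * complex_of_real pi * \<i> * complex_of_real (\<xi> \<bullet> x)) * f x) \<partial>M)"
    unfolding fourier_def by (simp add: mult_ac)
  then show ?thesis by (simp add: fourier_def)
qed

lemma fourier_cong_AE:
  assumes "f \<in> borel_measurable M" "g \<in> borel_measurable M" "sets M = sets borel" "AE x in M. f x = g x"
  shows "fourier M f = fourier M g"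
proof
  fix \<xi>
  note assms(1,2)[measurable] assms(3)[measurable_cong]
  show "fourier M f \<xi> = fourier M g \<xi>"
    unfolding fourier_def by (rule integral_cong_AE) (use assms(4) in \<open>auto elim: eventually_mono\<close>)
qed

section \<open>Restriction estimates for integrable functions, and Cauchy-Schwarz\<close>

text \<open>Scaling \<open>h\<close> to norm one reduces to the normalized Young bound; the constant
  is the square root of its value \<open>1 + 2 * K\<close>. Norms 0 and infinity cannot be scaled
  away and are treated apart.\<close>

lemma Lp_norm_fourier_le:
  fixes \<mu> :: "'a::euclidean_space measure"
  assumes sets: "sets \<mu> = sets borel" and "finite_measure \<mu>"
    and exps: "r \<ge> 1" "p > 0" "2 / p + 1 / r = 2"
    and K: "(\<integral>\<^sup>+x. ennreal (norm (fourier \<mu> (\<lambda>_. 1) x) powr r) \<partial>lborel) = K"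
    and h: "integrable lborel h"
  shows "Lp_norm 2 \<mu> (fourier lborel h) \<le> epowr (1 + 2 * K) (1 / 2) * Lp_norm (ereal p) lborel h"
proof -
  interpret finite_measure \<mu> by fact
  note sets[measurable_cong]
  have mh [measurable]: "h \<in> borel_measurable borel" using borel_measurable_integrable[OF h] by simp
  have [measurable]: "fourier \<mu> (\<lambda>_. 1) \<in> borel_measurable borel"
    by (rule borel_measurable_fourier) (use sets sigma_finite_measure_axioms in auto)
  define N where "N = Lp_norm (ereal p) lborel h"
  consider "N = 0" | "N = \<infinity>" | c where "c > 0" "N = ennreal c"
    by (cases N) (auto simp: less_le)
  then show ?thesis
  proof cases
    case 1
    then have "AE x in lborel. h x = 0"
      using Lp_norm_eq_0_AE[of p h lborel] exps by (simp add: N_def)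
    then have "fourier lborel h = fourier lborel (\<lambda>_. 0)"
      by (intro fourier_cong_AE) auto
    moreover have "fourier lborel (\<lambda>_. 0) = (\<lambda>_ :: 'a. 0)" by (simp add: fourier_def[abs_def])
    ultimately show ?thesis by (simp add: Lp_norm_ereal)
  next
    case 2
    \<comment> \<open>The summand 1 matters here: a zero constant times an infinite norm would be
      0.\<close>
    have "epowr (1 + 2 * K) (1/2) \<noteq> 0" by (simp add: epowr_eq_0_iff)
    then have "epowr (1 + 2 * K) (1/2) * N = \<infinity>" using 2 by (simp add: ennreal_mult_eq_top_iff)
    then show ?thesis by (simp add: N_def)
  next
    case 3
    define g where "g = (\<lambda>x. complex_of_real (1 / c) * h x)"
    have [measurable]: "g \<in> borel_measurable borel" by (simp add: g_def)
    have g: "integrable lborel g" unfolding g_def using h by simp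
    have "Lp_norm (ereal p) lborel g = ennreal (1 / c) * N"
      unfolding g_def N_def using exps 3 by (subst Lp_norm_cmult) (auto simp: norm_divide)
    also have "\<dots> = 1" using 3 by (simp add: ennreal_mult[symmetric])
    finally have "epowr (Lp_norm (ereal p) lborel g) p = 1" by simp
    then have gn: "(\<integral>\<^sup>+x. ennreal (norm (g x) powr p) \<partial>lborel) = 1"
      using exps by (simp add: Lp_norm_ereal epowr_epowr)
    have "(\<integral>\<^sup>+\<xi>. ennreal ((norm (fourier lborel g \<xi>))\<^sup>2) \<partial>\<mu>) \<le> 1 + 2 * K"
      by (rule order_trans[OF nn_integral_fourier_square_le[OF sets \<open>finite_measure \<mu>\<close> g]],
          rule young_bound_normalized[OF _ _ _ _ exps gn K]) auto
    then have le: "Lp_norm 2 \<mu> (fourier lborel g) \<le> epowr (1 + 2 * K) (1 / 2)"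
      unfolding Lp_norm_2 by (intro epowr_mono) auto
    have hg: "h = (\<lambda>x. complex_of_real c * g x)" using 3 by (auto simp: g_def)
    have "fourier lborel h = (\<lambda>\<xi>. complex_of_real c * fourier lborel g \<xi>)"
      by (subst hg, rule ext, rule fourier_cmult)
    then have "Lp_norm 2 \<mu> (fourier lborel h) = Lp_norm (ereal 2) \<mu> (\<lambda>\<xi>. complex_of_real c * fourier lborel g \<xi>)"
      by simp
    also have "\<dots> = ennreal c * Lp_norm 2 \<mu> (fourier lborel g)"
    proof (subst Lp_norm_cmult)
      have [measurable]: "fourier lborel g \<in> borel_measurable borel"
        by (rule borel_measurable_fourier) (auto intro: sigma_finite_lborel)
      show "fourier lborel g \<in> borel_measurable \<mu>" by measurable
    qed (use 3 in auto)
    also have "\<dots> \<le> N * epowr (1 + 2 * K) (1 / 2)"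
      using le 3 by (auto intro: mult_left_mono)
    finally show ?thesis by (simp add: N_def mult.commute)
  qed
qed

text \<open>The end point \<open>p = 1\<close>: the transform is bounded by the \<open>L^1\<close>
  norm, and \<open>\<mu>\<close> has finite mass.\<close>

lemma Lp_norm_fourier_le_L1:
  fixes \<mu> :: "'a::euclidean_space measure"
  assumes "finite_measure \<mu>" and h: "integrable lborel h"
  shows "Lp_norm 2 \<mu> (fourier lborel h) \<le> epowr (emeasure \<mu> (space \<mu>)) (1 / 2) * Lp_norm 1 lborel h"
proof -
  let ?B = "\<integral>x. norm (h x) \<partial>lborel"
  have B: "Lp_norm 1 lborel h = ennreal ?B"
    using Lp_norm_ereal[of 1 lborel h] nn_integral_eq_integral[of lborel "\<lambda>x. norm (h x)"] h
    by (simp add: one_ereal_def)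
  have "(\<integral>\<^sup>+\<xi>. ennreal ((norm (fourier lborel h \<xi>))\<^sup>2) \<partial>\<mu>) \<le> (\<integral>\<^sup>+\<xi>. ennreal (?B\<^sup>2) \<partial>\<mu>)"
    by (intro nn_integral_mono ennreal_leI power_mono norm_fourier_le) simp
  then have "Lp_norm 2 \<mu> (fourier lborel h) \<le> epowr (ennreal (?B\<^sup>2) * emeasure \<mu> (space \<mu>)) (1/2)"
    unfolding Lp_norm_2 by (intro epowr_mono) auto
  also have "\<dots> = epowr (emeasure \<mu> (space \<mu>)) (1 / 2) * Lp_norm 1 lborel h"
    by (simp add: epowr_mult B powr_half_sqrt mult.commute)
  finally show ?thesis .
qed

text \<open>Cauchy-Schwarz for possibly infinite norms. For finite positive norms \<open>a\<close>
  and \<open>b\<close> it comes from \<open>2 s t \<le> (b / a) s^2 + (a / b) t^2\<close>, the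
  weights being chosen so that both terms contribute \<open>a b / 2\<close>. If one norm is 0 the
  product of norms is 0 even when the other is infinite, so the integrand must then be shown to
  vanish a.e.\<close>

lemma nn_integral_norm_mult_le_Lp_norm_2:
  assumes [measurable]: "f \<in> borel_measurable M" "g \<in> borel_measurable M"
  shows "(\<integral>\<^sup>+x. ennreal (norm (f x) * norm (g x)) \<partial>M) \<le> Lp_norm 2 M f * Lp_norm 2 M g"
proof -
  define A where "A = Lp_norm 2 M f"
  define B where "B = Lp_norm 2 M g"
  have sq: "(\<integral>\<^sup>+x. ennreal ((norm (h x))\<^sup>2) \<partial>M) = epowr (Lp_norm 2 M h) 2" for h
    unfolding Lp_norm_2 by (simp add: epowr_epowr)
  have zero: "AE x in M. h x = 0" if "Lp_norm 2 M h = 0" "h \<in> borel_measurable M" for h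
    using Lp_norm_eq_0_AE[of 2 h M] that by simp
  consider "A = 0 \<or> B = 0" | "A \<noteq> 0" "B \<noteq> 0" "A = \<infinity> \<or> B = \<infinity>"
    | a b where "a > 0" "b > 0" "A = ennreal a" "B = ennreal b"
    by (cases A; cases B) (auto simp: less_le)
  then show ?thesis
  proof cases
    case 1
    then have "AE x in M. f x = 0 \<or> g x = 0"
      using zero[of f] zero[of g] unfolding A_def B_def by (auto elim: eventually_mono)
    then have "AE x in M. ennreal (norm (f x) * norm (g x)) = 0"
      by (rule eventually_mono) auto
    then have "(\<integral>\<^sup>+x. ennreal (norm (f x) * norm (g x)) \<partial>M) = 0"
      by (subst nn_integral_0_iff_AE) auto
    then show ?thesis by simp
  next
    case 2
    then have "A * B = \<infinity>" by (auto simp: ennreal_mult_eq_top_iff)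
    then show ?thesis by (simp add: A_def B_def)
  next
    case 3
    have young: "norm (f x) * norm (g x) \<le> b / (2 * a) * (norm (f x))\<^sup>2 + a / (2 * b) * (norm (g x))\<^sup>2" for x
    proof -
      have "0 \<le> (b * norm (f x) - a * norm (g x))\<^sup>2 / (2 * a * b)" using 3 by simp
      also have "\<dots> = b / (2 * a) * (norm (f x))\<^sup>2 + a / (2 * b) * (norm (g x))\<^sup>2 - norm (f x) * norm (g x)"
        using 3 by (simp add: power2_eq_square field_simps)
      finally show ?thesis by simp
    qed
    have sqA: "(\<integral>\<^sup>+x. ennreal ((norm (f x))\<^sup>2) \<partial>M) = ennreal (a\<^sup>2)"
      unfolding sq A_def[symmetric] using 3 by simp
    have sqB: "(\<integral>\<^sup>+x. ennreal ((norm (g x))\<^sup>2) \<partial>M) = ennreal (b\<^sup>2)"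
      unfolding sq B_def[symmetric] using 3 by simp
    have "(\<integral>\<^sup>+x. ennreal (norm (f x) * norm (g x)) \<partial>M)
        \<le> (\<integral>\<^sup>+x. ennreal (b / (2 * a)) * ennreal ((norm (f x))\<^sup>2) + ennreal (a / (2 * b)) * ennreal ((norm (g x))\<^sup>2) \<partial>M)"
      using 3 by (intro nn_integral_mono)
        (simp only: ennreal_mult[symmetric] ennreal_plus[symmetric] young zero_le_power2 ennreal_leI
          divide_nonneg_nonneg mult_nonneg_nonneg less_imp_le zero_le_numeral)
    also have "\<dots> = ennreal (b / (2 * a)) * ennreal (a\<^sup>2) + ennreal (a / (2 * b)) * ennreal (b\<^sup>2)"
      using sqA sqB by (simp add: nn_integral_add nn_integral_cmult)
    also have "\<dots> = ennreal (a * b)"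
      using 3 by (simp add: ennreal_mult[symmetric] ennreal_plus[symmetric] power2_eq_square del: ennreal_plus)
    also have "\<dots> = A * B" using 3 by (simp add: ennreal_mult)
    finally show ?thesis by (simp add: A_def B_def)
  qed
qed

text \<open>Cauchy-Schwarz against the constant 1. It embeds \<open>L^2(\<mu>)\<close> in
  \<open>L^1(\<mu>)\<close>, so that the transform of \<open>f\<close> times \<open>\<mu>\<close> is
  a convergent integral.\<close>

lemma (in finite_measure) nn_integral_norm_le_Lp_norm_2:
  assumes "f \<in> borel_measurable M"
  shows "(\<integral>\<^sup>+x. ennreal (norm (f x)) \<partial>M) \<le> epowr (emeasure M (space M)) (1 / 2) * Lp_norm 2 M f"
  using nn_integral_norm_mult_le_Lp_norm_2[OF _ assms, of "\<lambda>_. 1"]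
  by (simp add: Lp_norm_ereal)

lemma (in finite_measure) epowr_emeasure_less_top: "epowr (emeasure M A) a < \<infinity>"
  unfolding epowr_less_top_iff by (simp add: less_top[symmetric])

lemma (in finite_measure) Lp_space_2_integrable:
  assumes "f \<in> Lp_space 2 M"
  shows "integrable M f"
proof (rule integrableI_bounded)
  show [measurable]: "f \<in> borel_measurable M" using assms by (simp add: Lp_space_def)
  have "Lp_norm 2 M f < \<infinity>" using assms by (simp only: Lp_space_def mem_Collect_eq)
  moreover have "epowr (emeasure M (space M)) (1 / 2) < \<infinity>"
    by (rule epowr_emeasure_less_top)
  ultimately have "epowr (emeasure M (space M)) (1 / 2) * Lp_norm 2 M f < \<infinity>"
    by (simp add: ennreal_mult_less_top)
  then show "(\<integral>\<^sup>+x. ennreal (norm (f x)) \<partial>M) < \<infinity>"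
    using nn_integral_norm_le_Lp_norm_2[of f] by (meson \<open>f \<in> borel_measurable M\<close> order_le_less_trans)
qed

section \<open>From the Fourier spectrum to integrability of the transform of the measure\<close>

text \<open>The energy controls the integral only away from the origin, where its weight is at least
  1; on the unit ball the transform is bounded by \<open>B\<close> and the volume is finite. The
  surplus power \<open>r - 2 / \<theta>\<close> is absorbed by the same \<open>B\<close>.\<close>

lemma nn_integral_fourier_powr_finite:
  fixes \<mu> :: "'a::euclidean_space measure"
  assumes sets: "sets \<mu> = sets borel" and "finite_measure \<mu>"
    and \<theta>: "\<theta> \<in> admissible \<mu>" "\<theta> > 0" and r: "r \<ge> 2 / \<theta>"
  shows "(\<integral>\<^sup>+x. ennreal (norm (fourier \<mu> (\<lambda>_. 1) x) powr r) \<partial>lborel) < \<infinity>"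
proof -
  interpret finite_measure \<mu> by fact
  define m where "m = (\<lambda>x. norm (fourier \<mu> (\<lambda>_. 1) x))"
  have [measurable]: "m \<in> borel_measurable borel"
    unfolding m_def using borel_measurable_fourier[of \<mu> "\<lambda>_. 1"] sets sigma_finite_measure_axioms by auto
  define B where "B = max 1 (\<integral>x. norm (1 :: complex) \<partial>\<mu>)"
  have B: "B \<ge> 1" by (simp add: B_def)
  have m: "0 \<le> m x" "m x \<le> B" for x
    using norm_fourier_le[of \<mu> "\<lambda>_. 1" x] by (auto simp: m_def B_def)
  have "fourier_dim \<theta> \<mu> > ereal (real DIM('a) * \<theta>)" and "\<theta> \<le> 1"
    using \<theta> by (auto simp: admissible_def)
  \<comment> \<open>The default value 0 of \<open>fourier_dim\<close> does not exceed
    \<open>DIM('a) * \<theta>\<close>, so the set of finite-energy exponents is non-empty and its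
    supremum is approached by some \<open>s\<close>.\<close>
  then obtain s where s: "fourier_energy s \<theta> \<mu> < \<infinity>" "s > real DIM('a) * \<theta>"
    using \<theta>(2) by (auto simp: fourier_dim_def Let_def less_Sup_iff mult_less_0_iff split: if_splits)
  define t where "t = s / \<theta> - real DIM('a)"
  have t: "t > 0" using s(2) \<theta>(2) by (simp add: t_def field_simps)
  have E: "(\<integral>\<^sup>+x. ennreal (m x powr (2 / \<theta>) * norm x powr t) \<partial>lborel) < \<infinity>"
    using s(1) \<theta>(2) by (simp add: fourier_energy_def epowr_less_top_iff[unfolded infinity_ennreal_def] m_def t_def)
  have "m x powr r \<le> B powr (r - 2 / \<theta>) * (B powr (2 / \<theta>) * indicator (cball 0 1) x + m x powr (2 / \<theta>) * norm x powr t)" for x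
  proof -
    have "m x powr r = m x powr (r - 2 / \<theta>) * m x powr (2 / \<theta>)"
      by (simp add: powr_add[symmetric])
    also have "\<dots> \<le> B powr (r - 2 / \<theta>) * (B powr (2 / \<theta>) * indicator (cball 0 1) x + m x powr (2 / \<theta>) * norm x powr t)"
    proof (intro mult_mono)
      show "m x powr (r - 2 / \<theta>) \<le> B powr (r - 2 / \<theta>)"
        using m r by (intro powr_mono2) auto
      show "m x powr (2 / \<theta>) \<le> B powr (2 / \<theta>) * indicator (cball 0 1) x + m x powr (2 / \<theta>) * norm x powr t"
      proof (cases "norm x \<le> 1")
        case True
        then show ?thesis using m[of x] \<theta>(2)
          by (auto simp: indicator_def intro!: powr_mono2 add_increasing2)
      next
        case False
        then have "norm x powr t \<ge> 1" using t by (auto intro!: ge_one_powr_ge_zero)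
        then show ?thesis using False by (simp add: indicator_def mult_le_cancel_left1)
      qed
    qed auto
    finally show ?thesis .
  qed
  note le = this
  define G where "G = (\<lambda>x. ennreal (m x powr (2 / \<theta>) * norm x powr t))"
  define S where "S = cball (0::'a) 1"
  have [measurable]: "G \<in> borel_measurable borel" unfolding G_def by measurable
  have [measurable]: "S \<in> sets borel" by (simp add: S_def)
  have "(\<integral>\<^sup>+x. ennreal (m x powr r) \<partial>lborel) \<le>
      (\<integral>\<^sup>+x. ennreal (B powr (r - 2 / \<theta>)) * (ennreal (B powr (2 / \<theta>)) * indicator S x + G x) \<partial>lborel)"
    unfolding G_def S_def using le
    by (intro nn_integral_mono) (simp add: ennreal_mult[symmetric] ennreal_plus[symmetric] ennreal_indicator[symmetric] ennreal_leI del: ennreal_plus)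
  also have "\<dots> = ennreal (B powr (r - 2 / \<theta>)) * (ennreal (B powr (2 / \<theta>)) * emeasure lborel S + (\<integral>\<^sup>+x. G x \<partial>lborel))"
    by (simp add: nn_integral_cmult nn_integral_add)
  also have "\<dots> < \<infinity>"
    using E emeasure_lborel_cball_finite[of "0::'a" 1] by (simp add: ennreal_mult_less_top G_def S_def)
  finally show ?thesis by (simp add: m_def)
qed

lemma exists_ennreal_bound:
  assumes "c < \<infinity>"
  shows "\<exists>C::real. C > 0 \<and> c \<le> ennreal C"
  using assms by (cases c) (auto intro!: exI[of _ "max 1 (enn2real c)"] ennreal_leI)

text \<open>The exponent \<open>p\<close> lies below \<open>4 / (4 - \<theta>)\<close> for a single
  admissible \<open>\<theta>\<close>, and this is exactly what places the Young partner
  \<open>r\<close> of \<open>p\<close> in the range where the transform of \<open>\<mu>\<close> is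
  in \<open>L^r\<close>.\<close>

lemma fourier_restriction_bound:
  fixes \<mu> :: "'a::euclidean_space measure"
  assumes sets: "sets \<mu> = sets borel" and fin: "finite_measure \<mu>"
    and p: "1 \<le> p" "ereal p < (SUP \<theta>\<in>admissible \<mu>. ereal (4 / (4 - \<theta>)))"
  shows "\<exists>C>0. \<forall>h. integrable lborel h \<longrightarrow>
    Lp_norm 2 \<mu> (fourier lborel h) \<le> ennreal C * Lp_norm (ereal p) lborel h"
proof -
  interpret finite_measure \<mu> by fact
  have "\<exists>c<\<infinity>. \<forall>h. integrable lborel h \<longrightarrow> Lp_norm 2 \<mu> (fourier lborel h) \<le> c * Lp_norm (ereal p) lborel h"
  proof (cases "p = 1")
    case True
    have "epowr (emeasure \<mu> (space \<mu>)) (1 / 2) < \<infinity>"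
      by (rule epowr_emeasure_less_top)
    then show ?thesis
      using Lp_norm_fourier_le_L1[OF fin] True by (auto simp: one_ereal_def simp del: ereal_eq_1)
  next
    case False
    obtain \<theta> where \<theta>: "\<theta> \<in> admissible \<mu>" "p < 4 / (4 - \<theta>)"
      using p(2) by (auto simp: less_SUP_iff)
    have \<theta>_le: "0 \<le> \<theta>" "\<theta> \<le> 1" using \<theta>(1) by (auto simp: admissible_def)
    then have le: "4 * p - p * \<theta> < 4" using \<theta>(2) by (simp add: field_simps)
    \<comment> \<open>For \<open>\<theta> = 0\<close> the preceding inequality would read
      \<open>4 * p < 4\<close>.\<close>
    have "\<theta> \<noteq> 0" using p(1) le by auto
    then have pos: "\<theta> > 0" using \<theta>_le by simp
    \<comment> \<open>The solution of \<open>2 / p + 1 / r = 2\<close>; the bound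
      \<open>r \<ge> 2 / \<theta>\<close> is equivalent to
      \<open>4 * p - p * \<theta> \<le> 4\<close>.\<close>
    define r where "r = p / (2 * (p - 1))"
    have r: "r \<ge> 2 / \<theta>" using le pos False p(1) by (simp add: r_def field_simps)
    have "2 / \<theta> \<ge> 2" using pos \<theta>_le by (simp add: field_simps)
    then have r1: "r \<ge> 1" using r by simp
    have e: "2 / p + 1 / r = 2" using False p(1) by (simp add: r_def field_simps)
    have "epowr (1 + 2 * (\<integral>\<^sup>+x. ennreal (norm (fourier \<mu> (\<lambda>_. 1) x) powr r) \<partial>lborel)) (1 / 2) < \<infinity>"
      unfolding epowr_less_top_iff using nn_integral_fourier_powr_finite[OF sets fin \<theta>(1) pos r]
      by (simp add: ennreal_mult_less_top)
    then show ?thesis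
      using Lp_norm_fourier_le[OF sets fin r1 _ e refl] p(1) by (intro exI conjI) auto
  qed
  then obtain c where c: "c < \<infinity>" "\<And>h. integrable lborel h \<Longrightarrow>
      Lp_norm 2 \<mu> (fourier lborel h) \<le> c * Lp_norm (ereal p) lborel h"
    by blast
  obtain C where "C > 0" "c \<le> ennreal C" using exists_ennreal_bound[OF c(1)] by blast
  then show ?thesis
    using c(2) by (meson mult_right_mono order_trans zero_le)
qed

section \<open>The extension estimate by duality\<close>

text \<open>With \<open>J n\<close> the integral of \<open>|u|^q\<close> over a ball, the test
  function satisfies \<open>h * u = |u|^q\<close> and \<open>|h|^p = |u|^q\<close> there, because
  \<open>(q - 1) * p = q\<close>. The multiplication formula, Cauchy-Schwarz in
  \<open>L^2(\<mu>)\<close> and the assumed bound give \<open>J \<le> C * J^(1/p) * A\<close>, which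
  improves itself to \<open>J^(1/q) \<le> C * A\<close>. The constant does not depend on the
  radius.\<close>

lemma Lp_norm_extension_bound:
  fixes \<mu> :: "'a::euclidean_space measure"
  assumes sets: "sets \<mu> = sets borel" and fin: "finite_measure \<mu>"
    and q: "q > 1" and C: "C > 0"
    and bound: "\<And>h. integrable lborel h \<Longrightarrow>
      Lp_norm 2 \<mu> (fourier lborel h) \<le> ennreal C * Lp_norm (ereal (q / (q - 1))) lborel h"
    and f: "f \<in> Lp_space 2 \<mu>"
  shows "Lp_norm (ereal q) lborel (fourier \<mu> f) \<le> ennreal C * Lp_norm 2 \<mu> f"
proof -
  interpret finite_measure \<mu> by fact
  note sets[measurable_cong]
  define u where "u = fourier \<mu> f"
  define B where "B = (\<integral>x. norm (f x) \<partial>\<mu>)"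
  define A where "A = Lp_norm 2 \<mu> f"
  define p where "p = q / (q - 1)"
  have p: "p > 0" "(q - 1) * p = q" "1 - 1 / p = 1 / q" using q by (auto simp: p_def field_simps)
  have intf: "integrable \<mu> f" by (rule Lp_space_2_integrable[OF f])
  have mf [measurable]: "f \<in> borel_measurable \<mu>" using intf by auto
  have A: "A < \<infinity>" using f unfolding A_def Lp_space_def by blast
  have mu [measurable]: "u \<in> borel_measurable borel"
    unfolding u_def by (rule borel_measurable_fourier[OF sigma_finite_measure_axioms sets mf])
  have B: "norm (u x) \<le> B" for x unfolding u_def B_def by (rule norm_fourier_le)
  define J where "J n = (\<integral>\<^sup>+x. ennreal (norm (u x) powr q) * indicator (ball 0 (real n)) x \<partial>lborel)" for n :: nat
  have J: "J n \<le> epowr (ennreal C * A) q" for n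
  proof (cases "J n = 0")
    case False
    have ball: "emeasure lborel (ball 0 (real n) :: 'a set) < \<infinity>" by (rule emeasure_lborel_ball_finite)
    define v where "v = (\<lambda>x. cnj (u x))"
    \<comment> \<open>For \<open>q < 2\<close> the negative power does no harm at zeros of
      \<open>u\<close>: there \<open>v\<close> vanishes, and \<open>0 powr (q - 2)\<close> is 0 as
      well.\<close>
    define h where "h = (\<lambda>x. indicator (ball 0 (real n)) x *\<^sub>R (v x * complex_of_real (norm (u x) powr (q - 2))))"
    have [measurable]: "v \<in> borel_measurable borel"
      unfolding v_def by (rule measurable_compose[OF mu borel_measurable_continuous_onI])
        (auto intro!: continuous_intros)
    have [measurable]: "ball (0::'a) (real n) \<in> sets borel" by simp
    have [measurable]: "h \<in> borel_measurable borel" unfolding h_def by measurable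
    have nh: "norm (h x) = indicator (ball 0 (real n)) x * norm (u x) powr (q - 1)" for x
      by (cases "u x = 0") (auto simp: h_def v_def norm_mult norm_divide powr_diff power2_eq_square split: split_indicator)
    have uh: "h x * u x = complex_of_real (indicator (ball 0 (real n)) x * norm (u x) powr q)" for x
    proof (cases "u x = 0")
      case False
      have "cnj (u x) * u x = complex_of_real ((norm (u x))\<^sup>2)"
        by (metis complex_norm_square mult.commute of_real_power)
      then have "cnj (u x) * complex_of_real (norm (u x) powr (q - 2)) * u x
          = complex_of_real ((norm (u x))\<^sup>2 * norm (u x) powr (q - 2))"
        by (simp add: mult.commute mult.left_commute)
      also have "(norm (u x))\<^sup>2 * norm (u x) powr (q - 2) = norm (u x) powr q"
        using False by (simp add: powr_diff)
      finally show ?thesis by (simp add: h_def v_def split: split_indicator)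
    qed (simp add: h_def v_def)
    have h: "integrable lborel h"
    proof (rule Bochner_Integration.integrable_bound)
      show "integrable lborel (\<lambda>x. B powr (q - 1) * indicator (ball (0::'a) (real n)) x :: real)"
        using ball by (intro integrable_mult_right integrable_real_indicator) auto
      show "AE x in lborel. norm (h x) \<le> norm (B powr (q - 1) * indicator (ball 0 (real n)) x)"
        using B q by (auto simp: nh intro!: powr_mono2 split: split_indicator)
    qed simp
    \<comment> \<open>Here the ball is essential: \<open>u\<close> is bounded by \<open>B\<close>
      and the ball has finite volume, so \<open>J n\<close> is finite.\<close>
    have intI: "integrable lborel (\<lambda>x. indicator (ball 0 (real n)) x * norm (u x) powr q)"
    proof (rule Bochner_Integration.integrable_bound)
      show "integrable lborel (\<lambda>x. B powr q * indicator (ball (0::'a) (real n)) x :: real)"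
        using ball by (intro integrable_mult_right integrable_real_indicator) auto
      show "AE x in lborel. norm (indicator (ball 0 (real n)) x * norm (u x) powr q) \<le> norm (B powr q * indicator (ball 0 (real n)) x)"
        using B q by (auto intro!: powr_mono2 split: split_indicator)
    qed simp
    have J_eq: "J n = ennreal (\<integral>x. indicator (ball 0 (real n)) x * norm (u x) powr q \<partial>lborel)"
      unfolding J_def using nn_integral_eq_integral[OF intI]
      by (simp add: ennreal_mult ennreal_indicator mult.commute)
    have "Lp_norm (ereal p) lborel h = epowr (J n) (1 / p)"
      unfolding Lp_norm_ereal J_def using p
      by (intro arg_cong2[where f = epowr] nn_integral_cong)
        (auto simp: nh powr_powr split: split_indicator)
    then have hL: "Lp_norm 2 \<mu> (fourier lborel h) \<le> ennreal C * epowr (J n) (1 / p)"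
      using bound[OF h] by (simp only: p_def)
    have "complex_of_real (\<integral>x. indicator (ball 0 (real n)) x * norm (u x) powr q \<partial>lborel) = (\<integral>x. h x * u x \<partial>lborel)"
      unfolding uh by (rule integral_complex_of_real[symmetric])
    also have "\<dots> = (\<integral>\<xi>. fourier lborel h \<xi> * f \<xi> \<partial>\<mu>)"
      unfolding u_def by (rule fourier_multiplication[symmetric])
        (use sets h intf sigma_finite_measure_axioms in \<open>auto intro: sigma_finite_lborel\<close>)
    finally have eq: "complex_of_real (\<integral>x. indicator (ball 0 (real n)) x * norm (u x) powr q \<partial>lborel) = \<dots>" .
    have [measurable]: "fourier lborel h \<in> borel_measurable borel"
      by (rule borel_measurable_fourier) (auto intro: sigma_finite_lborel)
    have "J n = ennreal (norm (complex_of_real (\<integral>x. indicator (ball 0 (real n)) x * norm (u x) powr q \<partial>lborel)))"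
      unfolding J_eq by simp
    also have "\<dots> \<le> (\<integral>\<^sup>+\<xi>. ennreal (norm (fourier lborel h \<xi>) * norm (f \<xi>)) \<partial>\<mu>)"
      unfolding eq using norm_integral_le_nn_integral[of \<mu> "\<lambda>\<xi>. fourier lborel h \<xi> * f \<xi>"] by (simp add: norm_mult)
    also have "\<dots> \<le> Lp_norm 2 \<mu> (fourier lborel h) * A"
      unfolding A_def by (rule nn_integral_norm_mult_le_Lp_norm_2) measurable
    also have "\<dots> \<le> ennreal C * epowr (J n) (1 / p) * A"
      by (intro mult_right_mono hL) simp
    finally have le: "J n \<le> ennreal C * epowr (J n) (1 / p) * A" .
    \<comment> \<open>\<open>J n\<close> is now a positive real, so dividing by
      \<open>j powr (1 / p)\<close> is legitimate and leaves the power
      \<open>1 - 1 / p = 1 / q\<close>.\<close>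
    obtain j where j: "J n = ennreal j" "j > 0"
      using J_eq False by (metis ennreal_neg not_le)
    obtain a where a: "A = ennreal a" "a \<ge> 0" using A by (cases A) auto
    have "j \<le> C * j powr (1 / p) * a"
      using le j a C by (simp add: ennreal_mult[symmetric])
    then have "j / j powr (1 / p) \<le> C * a" using j by (simp add: field_simps)
    moreover have "j / j powr (1 / p) = j powr (1 / q)"
      using j p(3)[symmetric] by (simp add: powr_diff)
    ultimately have "(j powr (1 / q)) powr q \<le> (C * a) powr q"
      using q by (intro powr_mono2) auto
    then have "j \<le> (C * a) powr q" using j q by (simp add: powr_powr)
    then show ?thesis using a j C by (simp add: ennreal_mult[symmetric] ennreal_leI)
  qed simp
  have "(\<integral>\<^sup>+x. ennreal (norm (u x) powr q) \<partial>lborel) = (\<integral>\<^sup>+x. (SUP n. ennreal (norm (u x) powr q) * indicator (ball 0 (real n)) x) \<partial>lborel)"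
  proof (rule nn_integral_cong)
    fix x :: 'a
    obtain n :: nat where n: "norm x < real n" using reals_Archimedean2 by blast
    show "ennreal (norm (u x) powr q) = (SUP n. ennreal (norm (u x) powr q) * indicator (ball 0 (real n)) x)"
    proof (rule antisym)
      show "ennreal (norm (u x) powr q) \<le> (SUP n. ennreal (norm (u x) powr q) * indicator (ball 0 (real n)) x)"
        by (rule SUP_upper2[of n]) (use n in auto)
    qed (auto intro!: SUP_least split: split_indicator)
  qed
  also have "\<dots> = (SUP n. J n)"
    unfolding J_def
  proof (rule nn_integral_monotone_convergence_SUP)
    fix n :: nat
    have [measurable]: "ball (0::'a) (real n) \<in> sets borel" by simp
    show "(\<lambda>x. ennreal (norm (u x) powr q) * indicator (ball 0 (real n)) x) \<in> borel_measurable lborel"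
      by measurable
  qed (auto simp: incseq_def le_fun_def split: split_indicator)
  also have "\<dots> \<le> epowr (ennreal C * A) q" by (intro SUP_least J)
  finally have "Lp_norm (ereal q) lborel u \<le> epowr (epowr (ennreal C * A) q) (1 / q)"
    unfolding Lp_norm_ereal using q by (intro epowr_mono) auto
  then show ?thesis using q by (simp add: epowr_epowr u_def A_def)
qed

text \<open>The end point \<open>q = \<infinity>\<close>: the transform is bounded everywhere by the
  \<open>L^1(\<mu>)\<close> norm of \<open>f\<close>, hence by its \<open>L^2(\<mu>)\<close>
  norm.\<close>

lemma Lp_norm_infinity_fourier_le:
  fixes \<mu> :: "'a::euclidean_space measure"
  assumes sets: "sets \<mu> = sets borel" and fin: "finite_measure \<mu>" and f: "f \<in> Lp_space 2 \<mu>"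
  shows "Lp_norm \<infinity> lborel (fourier \<mu> f) \<le> epowr (emeasure \<mu> (space \<mu>)) (1 / 2) * Lp_norm 2 \<mu> f"
proof -
  interpret finite_measure \<mu> by fact
  have intf: "integrable \<mu> f" by (rule Lp_space_2_integrable[OF f])
  then have mf: "f \<in> borel_measurable \<mu>" by auto
  have [measurable]: "fourier \<mu> f \<in> borel_measurable borel"
    by (rule borel_measurable_fourier[OF sigma_finite_measure_axioms sets mf])
  have "ennreal (norm (fourier \<mu> f x)) \<le> epowr (emeasure \<mu> (space \<mu>)) (1 / 2) * Lp_norm 2 \<mu> f" for x
  proof -
    have "ennreal (norm (fourier \<mu> f x)) \<le> (\<integral>\<^sup>+x. ennreal (norm (f x)) \<partial>\<mu>)"
      using norm_fourier_le[of \<mu> f x] nn_integral_eq_integral[of \<mu> "\<lambda>x. norm (f x)"] intf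
      by (simp add: ennreal_leI)
    then show ?thesis using nn_integral_norm_le_Lp_norm_2[OF mf] by (rule order_trans)
  qed
  then show ?thesis by (auto simp: Lp_norm_def intro!: esssup_I)
qed

lemma fourier_extension_bound:
  fixes \<mu> :: "'a::euclidean_space measure" and q :: ereal
  assumes sets: "sets \<mu> = sets borel" and fin: "finite_measure \<mu>"
    and q: "q > (INF \<theta>\<in>admissible \<mu>. 4 / ereal \<theta>)"
  shows "\<exists>C>0. \<forall>f\<in>Lp_space 2 \<mu>. Lp_norm q lborel (fourier \<mu> f) \<le> ennreal C * Lp_norm 2 \<mu> f"
proof -
  interpret finite_measure \<mu> by fact
  obtain \<theta> where \<theta>: "\<theta> \<in> admissible \<mu>" "4 / ereal \<theta> < q" using q unfolding INF_less_iff by blast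
  have \<theta>_le: "0 \<le> \<theta>" "\<theta> \<le> 1" using \<theta>(1) by (auto simp: admissible_def)
  have "\<theta> \<noteq> 0"
  proof
    assume "\<theta> = 0"
    then have "4 / ereal \<theta> = \<infinity>" by (simp add: divide_ereal_def)
    then show False using \<theta>(2) by simp
  qed
  then have pos: "\<theta> > 0" using \<theta>_le by simp
  have q': "ereal (4 / \<theta>) < q" using \<theta>(2) pos by (simp add: divide_ereal_def divide_inverse)
  show ?thesis
  proof (cases q)
    case (real t)
    then have t: "t > 4 / \<theta>" using q' by simp
    then have t\<theta>: "t * \<theta> > 4" using pos by (simp add: field_simps)
    have "4 / \<theta> \<ge> 4" using pos \<theta>_le by (simp add: field_simps)
    then have t4: "t > 4" using t by simp
    \<comment> \<open>After clearing denominators this is \<open>t * \<theta> > 4\<close>: the two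
      thresholds correspond under conjugation of exponents.\<close>
    have "t / (t - 1) < 4 / (4 - \<theta>)" using t4 t\<theta> \<theta>_le by (simp add: field_simps)
    then have "ereal (t / (t - 1)) < (SUP \<theta>\<in>admissible \<mu>. ereal (4 / (4 - \<theta>)))"
      using \<theta>(1) by (auto simp: less_SUP_iff)
    moreover have "1 \<le> t / (t - 1)" using t4 by (simp add: field_simps)
    ultimately obtain C where C: "C > 0" "\<And>h. integrable lborel h \<Longrightarrow>
        Lp_norm 2 \<mu> (fourier lborel h) \<le> ennreal C * Lp_norm (ereal (t / (t - 1))) lborel h"
      using fourier_restriction_bound[OF sets fin] by blast
    show ?thesis
      unfolding real using Lp_norm_extension_bound[OF sets fin _ C] C(1) t4
      by (intro exI[of _ C]) auto
  next
    case PInf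
    have "epowr (emeasure \<mu> (space \<mu>)) (1 / 2) < \<infinity>"
      by (rule epowr_emeasure_less_top)
    then obtain C where "C > 0" "epowr (emeasure \<mu> (space \<mu>)) (1 / 2) \<le> ennreal C"
      using exists_ennreal_bound by blast
    then show ?thesis
      unfolding PInf using Lp_norm_infinity_fourier_le[OF sets fin]
      by (meson mult_right_mono order_trans zero_le)
  qed (use q' in simp)
qed

section \<open>Schwartz functions: linearity and integrability\<close>

lemma schwartz_differentiable:
  "schwartz f \<Longrightarrow> set bs \<subseteq> Basis \<Longrightarrow> iterated_partial bs f differentiable (at x)"
  by (auto simp: schwartz_def)

lemma schwartz_continuous: "schwartz f \<Longrightarrow> continuous_on UNIV f"
  using schwartz_differentiable[of f "[]"]
  by (auto intro!: differentiable_imp_continuous_within continuous_at_imp_continuous_on)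

lemma schwartz_borel_measurable: "schwartz f \<Longrightarrow> f \<in> borel_measurable borel"
  by (rule borel_measurable_continuous_onI) (rule schwartz_continuous)

text \<open>\<open>frechet_derivative\<close> is a choice operator and is linear only where
  derivatives exist, so differentiability of all iterated partials of both functions feeds each step
  of the induction.\<close>

lemma iterated_partial_linear:
  assumes "schwartz f" "schwartz g" "set bs \<subseteq> Basis"
  shows "iterated_partial bs (\<lambda>x. c * f x + g x) = (\<lambda>x. c * iterated_partial bs f x + iterated_partial bs g x)"
  using assms(3)
proof (induction bs)
  case (Cons b bs)
  show ?case
  proof
    fix x
    let ?F = "iterated_partial bs f" and ?G = "iterated_partial bs g"
    have F: "(?F has_derivative frechet_derivative ?F (at x)) (at x)"
      and G: "(?G has_derivative frechet_derivative ?G (at x)) (at x)"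
      using Cons.prems assms(1,2) by (simp_all add: schwartz_differentiable flip: frechet_derivative_works)
    have "((\<lambda>x. c * ?F x + ?G x) has_derivative
        (\<lambda>v. c * frechet_derivative ?F (at x) v + frechet_derivative ?G (at x) v)) (at x)"
      by (intro has_derivative_add has_derivative_mult_right F G)
    then have "frechet_derivative (\<lambda>x. c * ?F x + ?G x) (at x) =
        (\<lambda>v. c * frechet_derivative ?F (at x) v + frechet_derivative ?G (at x) v)"
      by (rule frechet_derivative_at[symmetric])
    then show "iterated_partial (b # bs) (\<lambda>x. c * f x + g x) x =
        c * iterated_partial (b # bs) f x + iterated_partial (b # bs) g x"
      using Cons by simp
  qed
qed simp

lemma schwartz_linear:
  assumes "schwartz f" "schwartz g"
  shows "schwartz (\<lambda>x. c * f x + g x)"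
  unfolding schwartz_def
proof (intro allI impI conjI)
  fix bs :: "'a list" and x assume bs: "set bs \<subseteq> Basis"
  note D = iterated_partial_linear[OF assms bs]
  show "iterated_partial bs (\<lambda>x. c * f x + g x) differentiable at x"
    unfolding D using bs assms by (intro differentiable_add differentiable_mult differentiable_const schwartz_differentiable)
  fix k :: nat
  let ?F = "\<lambda>x. (1 + norm x) ^ k *\<^sub>R iterated_partial bs f x" and ?G = "\<lambda>x. (1 + norm x) ^ k *\<^sub>R iterated_partial bs g x"
  have "bounded (range ?F)" "bounded (range ?G)" using assms bs by (auto simp: schwartz_def)
  then obtain A B where AB: "\<And>x. norm (?F x) \<le> A" "\<And>x. norm (?G x) \<le> B"
    by (auto simp: bounded_iff)
  have "norm ((1 + norm x) ^ k *\<^sub>R (c * iterated_partial bs f x + iterated_partial bs g x)) \<le> norm c * A + B" for x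
  proof -
    have "norm ((1 + norm x) ^ k *\<^sub>R (c * iterated_partial bs f x + iterated_partial bs g x)) = norm (c * ?F x + ?G x)"
      by (simp add: algebra_simps)
    also have "\<dots> \<le> norm c * norm (?F x) + norm (?G x)"
      by (metis norm_mult norm_triangle_ineq)
    also have "\<dots> \<le> norm c * A + B" by (intro add_mono mult_left_mono AB) simp
    finally show ?thesis .
  qed
  then show "bounded (range (\<lambda>x. (1 + norm x) ^ k *\<^sub>R iterated_partial bs (\<lambda>x. c * f x + g x) x))"
    unfolding D by (auto simp: bounded_iff)
qed

text \<open>A shell with \<open>n \<le> norm x < n + 1\<close> lies in a ball of volume
  \<open>\<omega> * (n + 1)^d\<close>, on which the integrand is replaced by
  \<open>(n + 1)^(-d - 2)\<close>. The exponent \<open>d + 2\<close> is chosen to leave the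
  convergent series of \<open>1 / (n + 1)^2\<close>.\<close>

lemma nn_integral_inverse_power_finite:
  "(\<integral>\<^sup>+x. ennreal (1 / (1 + norm x) ^ (DIM('a) + 2)) \<partial>(lborel :: 'a::euclidean_space measure)) < \<infinity>"
proof -
  let ?d = "DIM('a)"
  define S where "S n = ball (0::'a) (real (Suc n))" for n
  have [measurable]: "S n \<in> sets borel" for n by (simp add: S_def)
  define \<omega> where "\<omega> = measure lborel (ball (0::'a) 1)"
  have S: "emeasure lborel (S n) = ennreal (real (Suc n) ^ ?d * \<omega>)" for n
    using emeasure_lborel_ball_finite[of "0::'a" "real (Suc n)"]
      content_ball_conv_unit_ball[of "real (Suc n)" "0::'a"]
    by (simp add: S_def emeasure_eq_ennreal_measure \<omega>_def less_top)
  have \<omega>: "\<omega> \<ge> 0" by (simp add: \<omega>_def)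
  have cancel: "ennreal (1 / c ^ (?d + 2)) * ennreal (c ^ ?d * \<omega>) = ennreal (\<omega> * (1 / c ^ 2))" if "c > 0" for c :: real
  proof -
    have "ennreal (1 / c ^ (?d + 2)) * ennreal (c ^ ?d * \<omega>) = ennreal (1 / c ^ (?d + 2) * (c ^ ?d * \<omega>))"
      using that \<omega> by (intro ennreal_mult[symmetric]) auto
    also have "1 / c ^ (?d + 2) * (c ^ ?d * \<omega>) = \<omega> * (1 / c ^ 2)"
      using that unfolding power_add by simp
    finally show ?thesis .
  qed
  have le_suminf: "f n \<le> (\<Sum>n. f n)" for f :: "nat \<Rightarrow> ennreal" and n
    using sum_le_suminf[of f "{n}"] by simp
  have "(\<integral>\<^sup>+x. ennreal (1 / (1 + norm x) ^ (?d + 2)) \<partial>(lborel :: 'a measure))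
      \<le> (\<integral>\<^sup>+x. (\<Sum>n. ennreal (1 / real (Suc n) ^ (?d + 2)) * indicator (S n) x) \<partial>lborel)"
  proof (rule nn_integral_mono)
    fix x :: 'a
    define n where "n = nat \<lfloor>norm x\<rfloor>"
    have n: "real n \<le> norm x" "norm x < real (Suc n)" by (auto simp: n_def) linarith
    have "ennreal (1 / (1 + norm x) ^ (?d + 2)) \<le> ennreal (1 / real (Suc n) ^ (?d + 2))"
      using n by (intro ennreal_leI divide_left_mono power_mono) auto
    also have "\<dots> = ennreal (1 / real (Suc n) ^ (?d + 2)) * indicator (S n) x"
      using n by (simp add: S_def)
    also have "\<dots> \<le> (\<Sum>n. ennreal (1 / real (Suc n) ^ (?d + 2)) * indicator (S n) x)"
      using le_suminf[of "\<lambda>n. ennreal (1 / real (Suc n) ^ (?d + 2)) * indicator (S n) x" n] .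
    finally show "ennreal (1 / (1 + norm x) ^ (?d + 2)) \<le> \<dots>" .
  qed
  also have "\<dots> = (\<Sum>n. ennreal (1 / real (Suc n) ^ (?d + 2)) * emeasure lborel (S n))"
    by (subst nn_integral_suminf) (simp_all add: nn_integral_cmult_indicator)
  also have "\<dots> = (\<Sum>n. ennreal (\<omega> * (1 / real (Suc n) ^ 2)))"
    unfolding S by (subst cancel) simp_all
  also have "\<dots> = ennreal (\<Sum>n. \<omega> * (1 / real (Suc n) ^ 2))"
  proof (rule suminf_ennreal2)
    have "summable (\<lambda>n. 1 / real (Suc n) ^ 2)"
      using inverse_power_summable[of 2, where 'a = real] by (subst summable_Suc_iff) (simp add: field_simps)
    then show "summable (\<lambda>n. \<omega> * (1 / real (Suc n) ^ 2))" by (rule summable_mult)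
  qed (simp add: \<omega>_def)
  finally show ?thesis by (simp add: order_le_less_trans)
qed

lemma schwartz_integrable:
  fixes f :: "'a::euclidean_space \<Rightarrow> complex"
  assumes "schwartz f"
  shows "integrable lborel f"
proof (rule integrableI_bounded)
  show "f \<in> borel_measurable lborel" using schwartz_borel_measurable[OF assms] by simp
  define k where "k = DIM('a) + 2"
  have "set [] \<subseteq> (Basis :: 'a set)" by simp
  then have "bounded (range (\<lambda>x. (1 + norm x) ^ k *\<^sub>R iterated_partial [] f x))"
    using assms unfolding schwartz_def by blast
  then obtain A where A: "\<And>x. norm ((1 + norm x) ^ k *\<^sub>R f x) \<le> A"
    by (auto simp: bounded_iff)
  have A0: "A \<ge> 0" using A[of 0] norm_ge_zero order_trans by blast
  have "norm (f x) \<le> A * (1 / (1 + norm x) ^ k)" for x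
    using A[of x] by (simp add: pos_le_divide_eq mult.commute add_pos_nonneg)
  then have "(\<integral>\<^sup>+x. ennreal (norm (f x)) \<partial>lborel) \<le> (\<integral>\<^sup>+x. ennreal A * ennreal (1 / (1 + norm x) ^ k) \<partial>(lborel :: 'a measure))"
    using A0 by (intro nn_integral_mono) (simp add: ennreal_mult[symmetric] ennreal_leI)
  also have "\<dots> = ennreal A * (\<integral>\<^sup>+x. ennreal (1 / (1 + norm x) ^ k) \<partial>(lborel :: 'a measure))"
    by (rule nn_integral_cmult) measurable
  also have "\<dots> < \<infinity>"
    using nn_integral_inverse_power_finite[where 'a = 'a] unfolding k_def[symmetric]
    by (simp add: ennreal_mult_less_top)
  finally show "(\<integral>\<^sup>+x. ennreal (norm (f x)) \<partial>lborel) < \<infinity>" .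
qed

section \<open>Polynomials times exponentials as Schwartz functions\<close>

lemma power_le_fact_mult_exp:
  fixes x :: real
  assumes "x \<ge> 0"
  shows "x ^ n \<le> fact n * exp x"
proof -
  have "(\<Sum>k\<in>{n}. x ^ k /\<^sub>R fact k) \<le> (\<Sum>k. x ^ k /\<^sub>R fact k)"
    using assms by (intro sum_le_suminf summable_exp_generic) auto
  then have "x ^ n / fact n \<le> exp x" by (simp add: exp_def divide_inverse mult.commute)
  then show ?thesis by (simp add: field_simps)
qed

text \<open>Directional derivatives are shown to be polynomial again, which lets the computation of
  iterated partials stay within one class of functions.\<close>

lemma real_polynomial_function_derivative:
  fixes p :: "'a::real_normed_vector \<Rightarrow> real"
  assumes "real_polynomial_function p"
  shows "\<exists>D. (\<forall>x. (p has_derivative D x) (at x)) \<and> (\<forall>v. real_polynomial_function (\<lambda>x. D x v))"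
  using assms
proof induction
  case (linear f)
  then show ?case
    by (intro exI[of _ "\<lambda>x. f"]) (auto intro: bounded_linear_imp_has_derivative)
next
  case (const c)
  then show ?case by (intro exI[of _ "\<lambda>x v. 0"]) auto
next
  case (add f g)
  then obtain D E where "\<forall>x. (f has_derivative D x) (at x)" "\<forall>v. real_polynomial_function (\<lambda>x. D x v)"
    "\<forall>x. (g has_derivative E x) (at x)" "\<forall>v. real_polynomial_function (\<lambda>x. E x v)" by blast
  then show ?case
    by (intro exI[of _ "\<lambda>x v. D x v + E x v"]) (auto intro: has_derivative_add)
next
  case (mult f g)
  then obtain D E where "\<forall>x. (f has_derivative D x) (at x)" "\<forall>v. real_polynomial_function (\<lambda>x. D x v)"
    "\<forall>x. (g has_derivative E x) (at x)" "\<forall>v. real_polynomial_function (\<lambda>x. E x v)" by blast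
  with mult.hyps show ?case
    by (intro exI[of _ "\<lambda>x v. f x * E x v + D x v * g x"]) (auto intro!: has_derivative_mult real_polynomial_function.intros(3,4))
qed

text \<open>The base \<open>1 + norm x\<close> is at least 1, so degrees may be added for sums as
  well as for products.\<close>

lemma real_polynomial_function_growth:
  fixes p :: "'a::real_normed_vector \<Rightarrow> real"
  assumes "real_polynomial_function p"
  shows "\<exists>A k. A \<ge> 0 \<and> (\<forall>x. \<bar>p x\<bar> \<le> A * (1 + norm x) ^ k)"
  using assms
proof induction
  case (linear f)
  then obtain K where K: "K \<ge> 0" "\<And>x. norm (f x) \<le> norm x * K"
    using bounded_linear.nonneg_bounded by blast
  have "\<bar>f x\<bar> \<le> K * (1 + norm x) ^ 1" for x
    using K(1) K(2)[of x] by (simp add: algebra_simps)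
  then show ?case using K(1) by blast
next
  case (const c)
  then show ?case by (intro exI[of _ "\<bar>c\<bar>"] exI[of _ 0]) auto
next
  case (add f g)
  then obtain A B k l where AB: "A \<ge> 0" "B \<ge> 0" "\<And>x. \<bar>f x\<bar> \<le> A * (1 + norm x) ^ k" "\<And>x. \<bar>g x\<bar> \<le> B * (1 + norm x) ^ l"
    by blast
  have "\<bar>f x + g x\<bar> \<le> (A + B) * (1 + norm x) ^ (k + l)" for x
  proof -
    have "\<bar>f x + g x\<bar> \<le> A * (1 + norm x) ^ k + B * (1 + norm x) ^ l"
      using AB(3)[of x] AB(4)[of x] by linarith
    also have "\<dots> \<le> A * (1 + norm x) ^ (k + l) + B * (1 + norm x) ^ (k + l)"
      using AB by (intro add_mono mult_left_mono power_increasing) auto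
    finally show ?thesis by (simp add: algebra_simps)
  qed
  then show ?case using AB by (intro exI[of _ "A + B"] exI[of _ "k + l"]) auto
next
  case (mult f g)
  then obtain A B k l where AB: "A \<ge> 0" "B \<ge> 0" "\<And>x. \<bar>f x\<bar> \<le> A * (1 + norm x) ^ k" "\<And>x. \<bar>g x\<bar> \<le> B * (1 + norm x) ^ l"
    by blast
  have "\<bar>f x * g x\<bar> \<le> (A * B) * (1 + norm x) ^ (k + l)" for x
  proof -
    have "\<bar>f x * g x\<bar> \<le> (A * (1 + norm x) ^ k) * (B * (1 + norm x) ^ l)"
      unfolding abs_mult using AB by (intro mult_mono) auto
    then show ?thesis by (simp add: power_add mult_ac)
  qed
  then show ?case using AB by (intro exI[of _ "A * B"] exI[of _ "k + l"]) auto
qed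

text \<open>The functions \<open>q * exp (- P)\<close> with polynomial \<open>q\<close> are closed
  under partial derivatives: differentiating in direction \<open>b\<close> replaces \<open>q\<close>
  by \<open>D_b q - q * D_b P\<close>.\<close>

lemma iterated_partial_polynomial_exp:
  fixes P :: "'a::euclidean_space \<Rightarrow> real"
  assumes P: "real_polynomial_function P" and p: "real_polynomial_function p"
  shows "\<exists>q. real_polynomial_function q \<and>
    iterated_partial bs (\<lambda>x. complex_of_real (p x * exp (- P x))) = (\<lambda>x. complex_of_real (q x * exp (- P x)))"
proof (induction bs)
  case (Cons b bs)
  then obtain q where q: "real_polynomial_function q"
    "iterated_partial bs (\<lambda>x. complex_of_real (p x * exp (- P x))) = (\<lambda>x. complex_of_real (q x * exp (- P x)))"
    by blast
  obtain D where D: "\<And>x. (q has_derivative D x) (at x)" "\<And>v. real_polynomial_function (\<lambda>x. D x v)"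
    using real_polynomial_function_derivative[OF q(1)] by blast
  obtain E where E: "\<And>x. (P has_derivative E x) (at x)" "\<And>v. real_polynomial_function (\<lambda>x. E x v)"
    using real_polynomial_function_derivative[OF P] by blast
  have "((\<lambda>x. complex_of_real (q x * exp (- P x))) has_derivative
      (\<lambda>v. complex_of_real ((D x v - q x * E x v) * exp (- P x)))) (at x)" for x
  proof -
    have "((\<lambda>x. q x * exp (- P x)) has_derivative (\<lambda>v. (D x v - q x * E x v) * exp (- P x))) (at x)"
      by (auto intro!: derivative_eq_intros D(1) E(1) simp: algebra_simps)
    then show ?thesis by (rule has_derivative_of_real)
  qed
  then have "frechet_derivative (\<lambda>x. complex_of_real (q x * exp (- P x))) (at x) =
      (\<lambda>v. complex_of_real ((D x v - q x * E x v) * exp (- P x)))" for x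
    by (rule frechet_derivative_at[symmetric])
  then have "iterated_partial (b # bs) (\<lambda>x. complex_of_real (p x * exp (- P x)))
      = (\<lambda>x. complex_of_real ((D x b - q x * E x b) * exp (- P x)))"
    unfolding iterated_partial.simps q(2) by simp
  moreover have "real_polynomial_function (\<lambda>x. D x b - q x * E x b)"
    using q(1) D(2) E(2) by (intro real_polynomial_function_diff real_polynomial_function.intros(4)) auto
  ultimately show ?case by (intro exI[of _ "\<lambda>x. D x b - q x * E x b"] conjI) auto
qed (use p in auto)

text \<open>Apply the factorial bound at \<open>\<epsilon> * (1 + t)\<close>; the factor
  \<open>exp \<epsilon>\<close> pays for the shift from \<open>t\<close> to
  \<open>1 + t\<close>.\<close>

lemma power_mult_exp_bounded:
  fixes t \<epsilon> :: real
  assumes "t \<ge> 0" "\<epsilon> > 0"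
  shows "(1 + t) ^ n * exp (- (\<epsilon> * t)) \<le> fact n / \<epsilon> ^ n * exp \<epsilon>"
proof -
  have "(\<epsilon> * (1 + t)) ^ n \<le> fact n * exp (\<epsilon> * (1 + t))"
    using assms by (intro power_le_fact_mult_exp) auto
  then have "(1 + t) ^ n \<le> fact n * exp (\<epsilon> * (1 + t)) / \<epsilon> ^ n"
    using assms unfolding power_mult_distrib by (simp add: pos_le_divide_eq mult.commute)
  then have "(1 + t) ^ n * exp (- (\<epsilon> * t)) \<le> fact n * exp (\<epsilon> * (1 + t)) / \<epsilon> ^ n * exp (- (\<epsilon> * t))"
    by (rule mult_right_mono) simp
  also have "\<dots> = fact n / \<epsilon> ^ n * exp \<epsilon>"
    by (simp add: exp_add[symmetric] algebra_simps)
  finally show ?thesis .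
qed

text \<open>Every iterated partial is a polynomial times \<open>exp (- P)\<close>. Linear growth of
  \<open>P\<close> makes this decay exponentially, which beats the polynomial of growth order
  \<open>l\<close> together with the weight of order \<open>k\<close>.\<close>

lemma schwartz_polynomial_exp:
  fixes P :: "'a::euclidean_space \<Rightarrow> real"
  assumes P: "real_polynomial_function P" and p: "real_polynomial_function p"
    and \<epsilon>: "\<epsilon> > 0" and coercive: "\<And>x. P x \<ge> \<epsilon> * norm x - M"
  shows "schwartz (\<lambda>x. complex_of_real (p x * exp (- P x)))"
  unfolding schwartz_def
proof (intro allI impI conjI)
  fix bs :: "'a list" and x :: 'a
  obtain q where q: "real_polynomial_function q"
    "iterated_partial bs (\<lambda>x. complex_of_real (p x * exp (- P x))) = (\<lambda>x. complex_of_real (q x * exp (- P x)))"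
    using iterated_partial_polynomial_exp[OF P p] by blast
  obtain D where D: "\<And>x. (q has_derivative D x) (at x)"
    using real_polynomial_function_derivative[OF q(1)] by blast
  obtain E where E: "\<And>x. (P has_derivative E x) (at x)"
    using real_polynomial_function_derivative[OF P] by blast
  have "((\<lambda>x. q x * exp (- P x)) has_derivative (\<lambda>v. (D x v - q x * E x v) * exp (- P x))) (at x)"
    by (auto intro!: derivative_eq_intros D(1) E(1) simp: algebra_simps)
  then have "((\<lambda>x. complex_of_real (q x * exp (- P x))) has_derivative (\<lambda>v. complex_of_real ((D x v - q x * E x v) * exp (- P x)))) (at x)"
    by (rule has_derivative_of_real)
  then show "iterated_partial bs (\<lambda>x. complex_of_real (p x * exp (- P x))) differentiable at x"
    unfolding q(2) by (rule differentiableI)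
  fix k :: nat
  obtain A l where A: "A \<ge> 0" "\<And>x. \<bar>q x\<bar> \<le> A * (1 + norm x) ^ l"
    using real_polynomial_function_growth[OF q(1)] by blast
  have "norm ((1 + norm x) ^ k *\<^sub>R complex_of_real (q x * exp (- P x)))
      \<le> A * exp M * (fact (k + l) / \<epsilon> ^ (k + l) * exp \<epsilon>)" for x
  proof -
    have "norm ((1 + norm x) ^ k *\<^sub>R complex_of_real (q x * exp (- P x))) = (1 + norm x) ^ k * (\<bar>q x\<bar> * exp (- P x))"
      by (simp add: norm_mult)
    also have "\<dots> \<le> (1 + norm x) ^ k * ((A * (1 + norm x) ^ l) * exp (M - \<epsilon> * norm x))"
      using coercive[of x] A by (intro mult_left_mono mult_mono) auto
    also have "\<dots> = A * exp M * ((1 + norm x) ^ (k + l) * exp (- (\<epsilon> * norm x)))"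
      by (simp add: power_add exp_diff exp_minus divide_inverse mult_ac)
    also have "\<dots> \<le> A * exp M * (fact (k + l) / \<epsilon> ^ (k + l) * exp \<epsilon>)"
      using A \<epsilon> by (intro mult_left_mono power_mult_exp_bounded) auto
    finally show ?thesis .
  qed
  then show "bounded (range (\<lambda>x. (1 + norm x) ^ k *\<^sub>R iterated_partial bs (\<lambda>x. complex_of_real (p x * exp (- P x))) x))"
    unfolding q(2) by (auto simp: bounded_iff)
qed

section \<open>A quasi-triangle inequality for \<open>L^p\<close> norms\<close>

lemma norm_add_powr_le:
  assumes "p \<ge> 0"
  shows "norm (a + b) powr p \<le> 2 powr p * (norm a powr p + norm b powr p)"
proof -
  let ?m = "max (norm a) (norm b)"
  have "norm (a + b) powr p \<le> (2 * ?m) powr p"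
    using assms norm_triangle_ineq[of a b] by (intro powr_mono2) auto
  also have "\<dots> = 2 powr p * ?m powr p" by (simp add: powr_mult)
  also have "\<dots> \<le> 2 powr p * (norm a powr p + norm b powr p)"
    by (intro mult_left_mono) (auto simp: max_def)
  finally show ?thesis .
qed

text \<open>Bound \<open>x + y\<close> by twice the maximum, which \<open>epowr\<close> respects by
  monotonicity. Together with the factor 2 from \<open>norm_add_powr_le\<close> this is the origin
  of the 4 in the triangle inequalities below.\<close>

lemma epowr_add_le:
  assumes "0 < a" "a \<le> 1"
  shows "epowr (x + y) a \<le> 2 * (epowr x a + epowr y a)"
proof -
  have "x + y \<le> 2 * max x y"
    using add_mono[of x "max x y" y "max x y"] by (simp add: mult_2)
  then have "epowr (x + y) a \<le> epowr 2 a * epowr (max x y) a"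
    using epowr_mono[of "x + y" "2 * max x y" a] assms by (simp add: epowr_mult)
  also have "epowr 2 a \<le> 2"
    using epowr_ennreal[of 2 a] ennreal_leI[OF powr_mono[of a 1 2]] assms by simp
  then have "epowr 2 a * epowr (max x y) a \<le> 2 * epowr (max x y) a" by (rule mult_right_mono) simp
  also have "\<dots> \<le> 2 * (epowr x a + epowr y a)"
    by (intro mult_left_mono) (auto simp: max_def)
  finally show ?thesis .
qed

text \<open>The constant is far from optimal (Minkowski gives 1), but a quasi-norm suffices here.\<close>

lemma Lp_norm_add_le:
  assumes p: "p \<ge> 1" and [measurable]: "f \<in> borel_measurable M" "g \<in> borel_measurable M"
  shows "Lp_norm (ereal p) M (\<lambda>x. f x + g x) \<le> 4 * (Lp_norm (ereal p) M f + Lp_norm (ereal p) M g)"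
proof -
  let ?A = "\<lambda>f. \<integral>\<^sup>+x. ennreal (norm (f x) powr p) \<partial>M"
  have "?A (\<lambda>x. f x + g x) \<le> (\<integral>\<^sup>+x. ennreal (2 powr p) * (ennreal (norm (f x) powr p) + ennreal (norm (g x) powr p)) \<partial>M)"
    using p by (intro nn_integral_mono)
      (simp add: norm_add_powr_le ennreal_leI flip: ennreal_plus ennreal_mult)
  also have "\<dots> = ennreal (2 powr p) * (?A f + ?A g)"
    by (simp add: nn_integral_cmult nn_integral_add)
  finally have "Lp_norm (ereal p) M (\<lambda>x. f x + g x) \<le> epowr (ennreal (2 powr p) * (?A f + ?A g)) (1 / p)"
    unfolding Lp_norm_ereal using p by (intro epowr_mono) auto
  also have "\<dots> = 2 * epowr (?A f + ?A g) (1 / p)"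
    using p by (simp add: epowr_mult powr_powr)
  also have "\<dots> \<le> 2 * (2 * (epowr (?A f) (1 / p) + epowr (?A g) (1 / p)))"
    using p by (intro mult_left_mono epowr_add_le) auto
  finally show ?thesis
    by (simp add: Lp_norm_ereal mult.assoc[symmetric])
qed

lemma Lp_norm_minus_commute: "Lp_norm (ereal p) M (\<lambda>x. f x - g x) = Lp_norm (ereal p) M (\<lambda>x. g x - f x)"
  by (simp add: Lp_norm_ereal norm_minus_commute)

lemma Lp_norm_diff_triangle:
  assumes "p \<ge> 1" and [measurable]: "f \<in> borel_measurable M" "g \<in> borel_measurable M" "h \<in> borel_measurable M"
  shows "Lp_norm (ereal p) M (\<lambda>x. f x - h x)
    \<le> 4 * (Lp_norm (ereal p) M (\<lambda>x. f x - g x) + Lp_norm (ereal p) M (\<lambda>x. g x - h x))"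
  using Lp_norm_add_le[of p "\<lambda>x. f x - g x" M "\<lambda>x. g x - h x"] assms(1) by simp

lemma Lp_norm_le_diff:
  assumes "p \<ge> 1" and [measurable]: "f \<in> borel_measurable M" "g \<in> borel_measurable M"
  shows "Lp_norm (ereal p) M f
    \<le> 4 * (Lp_norm (ereal p) M (\<lambda>x. f x - g x) + Lp_norm (ereal p) M g)"
  using Lp_norm_add_le[of p "\<lambda>x. f x - g x" M g] assms(1) by simp

section \<open>Density of the Schwartz functions\<close>

text \<open>The \<open>L^p\<close> closure of the Schwartz functions, with measurability bundled in
  so that the closure properties can be chained without side conditions.\<close>

definition schwartz_approximable :: "real \<Rightarrow> ('a::euclidean_space \<Rightarrow> complex) \<Rightarrow> bool" where
  "schwartz_approximable p f \<longleftrightarrow> f \<in> borel_measurable borel \<and>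
     (\<forall>e>0. \<exists>F. schwartz F \<and> Lp_norm (ereal p) lborel (\<lambda>x. F x - f x) \<le> ennreal e)"

lemma schwartz_approximable_measurable: "schwartz_approximable p f \<Longrightarrow> f \<in> borel_measurable borel"
  by (simp add: schwartz_approximable_def)

lemma schwartz_approximable_schwartz: "schwartz f \<Longrightarrow> schwartz_approximable p f"
  by (auto simp: schwartz_approximable_def schwartz_borel_measurable Lp_norm_ereal intro!: exI[of _ f])

lemma schwartz_approximable_linear:
  assumes p: "p \<ge> 1" and f: "schwartz_approximable p f" and g: "schwartz_approximable p g"
  shows "schwartz_approximable p (\<lambda>x. c * f x + g x)"
  unfolding schwartz_approximable_def
proof (intro conjI allI impI)
  have [measurable]: "f \<in> borel_measurable borel" "g \<in> borel_measurable borel"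
    using f g by (auto simp: schwartz_approximable_def)
  show "(\<lambda>x. c * f x + g x) \<in> borel_measurable borel" by measurable
  fix e :: real assume e: "e > 0"
  \<comment> \<open>The 4 is the quasi-triangle constant, and \<open>norm c + 1\<close> collects the
    errors of \<open>c * F\<close> and \<open>G\<close>.\<close>
  define d where "d = e / (4 * (norm c + 1))"
  have d: "d > 0" using e by (auto simp: d_def add_nonneg_pos)
  obtain F where F: "schwartz F" "Lp_norm (ereal p) lborel (\<lambda>x. F x - f x) \<le> ennreal d"
    using f d by (auto simp: schwartz_approximable_def)
  obtain G where G: "schwartz G" "Lp_norm (ereal p) lborel (\<lambda>x. G x - g x) \<le> ennreal d"
    using g d by (auto simp: schwartz_approximable_def)
  have [measurable]: "F \<in> borel_measurable borel" "G \<in> borel_measurable borel"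
    using F G by (auto intro: schwartz_borel_measurable)
  have "Lp_norm (ereal p) lborel (\<lambda>x. (c * F x + G x) - (c * f x + g x))
      = Lp_norm (ereal p) lborel (\<lambda>x. c * (F x - f x) + (G x - g x))"
    by (simp add: algebra_simps)
  also have "\<dots> \<le> 4 * (Lp_norm (ereal p) lborel (\<lambda>x. c * (F x - f x)) + Lp_norm (ereal p) lborel (\<lambda>x. G x - g x))"
    using p by (intro Lp_norm_add_le) auto
  also have "Lp_norm (ereal p) lborel (\<lambda>x. c * (F x - f x)) = ennreal (norm c) * Lp_norm (ereal p) lborel (\<lambda>x. F x - f x)"
    using p by (intro Lp_norm_cmult) auto
  also have "4 * (ennreal (norm c) * Lp_norm (ereal p) lborel (\<lambda>x. F x - f x) + Lp_norm (ereal p) lborel (\<lambda>x. G x - g x))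
     \<le> 4 * (ennreal (norm c) * ennreal d + ennreal d)"
    by (intro mult_left_mono add_mono F(2) G(2)) auto
  also have "\<dots> = ennreal (4 * (norm c * d + d))"
    using d by (simp add: ennreal_mult)
  also have "4 * (norm c * d + d) = e"
  proof -
    have "norm c + 1 \<noteq> 0" using norm_ge_zero[of c] by linarith
    then have "4 * (norm c + 1) * d = e" by (simp add: d_def)
    then show ?thesis by (simp add: algebra_simps)
  qed
  finally show "\<exists>F. schwartz F \<and> Lp_norm (ereal p) lborel (\<lambda>x. F x - (c * f x + g x)) \<le> ennreal e"
    using schwartz_linear[OF F(1) G(1), of c] by (intro exI[of _ "\<lambda>x. c * F x + G x"]) auto
qed

lemma schwartz_zero: "schwartz (\<lambda>x. 0)"
proof -
  have "iterated_partial bs (\<lambda>x :: 'a. 0) = (\<lambda>x. 0)" for bs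
    by (induction bs) auto
  then show ?thesis by (auto simp: schwartz_def)
qed

lemma schwartz_approximable_sum:
  assumes p: "p \<ge> 1" and "finite I" "\<And>i. i \<in> I \<Longrightarrow> schwartz_approximable p (f i)"
  shows "schwartz_approximable p (\<lambda>x. \<Sum>i\<in>I. c i * f i x)"
  using assms(2,3)
proof (induction I)
  case empty
  then show ?case using schwartz_approximable_schwartz[OF schwartz_zero] by simp
next
  case (insert i I)
  then show ?case
    using schwartz_approximable_linear[OF p, of "f i" "\<lambda>x. \<Sum>i\<in>I. c i * f i x" "c i"] by simp
qed

text \<open>Dominated convergence for \<open>|f n - g|^p\<close>: the limit inherits the bound by
  \<open>|w|\<close> a.e., so \<open>(2 |w|)^p\<close> is a majorant.\<close>

lemma Lp_norm_dominated_tendsto: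
  fixes f :: "nat \<Rightarrow> 'a \<Rightarrow> complex"
  assumes p: "p \<ge> 1" and [measurable]: "\<And>n. f n \<in> borel_measurable M" "g \<in> borel_measurable M" "w \<in> borel_measurable M"
    and w: "(\<integral>\<^sup>+x. ennreal (norm (w x) powr p) \<partial>M) < \<infinity>"
    and bound: "\<And>n. AE x in M. norm (f n x) \<le> norm (w x)"
    and lim: "AE x in M. (\<lambda>n. f n x) \<longlonglongrightarrow> g x"
    and e: "e > 0"
  shows "eventually (\<lambda>n. Lp_norm (ereal p) M (\<lambda>x. f n x - g x) \<le> ennreal e) sequentially"
proof -
  have "(\<lambda>n. \<integral>\<^sup>+x. ennreal (norm (f n x - g x) powr p) \<partial>M) \<longlonglongrightarrow> (\<integral>\<^sup>+x. 0 \<partial>M)"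
  proof (rule nn_integral_dominated_convergence)
    show "(\<integral>\<^sup>+x. ennreal (2 powr p) * ennreal (norm (w x) powr p) \<partial>M) < \<infinity>"
      using w by (subst nn_integral_cmult) (simp_all add: ennreal_mult_less_top)
    show "AE x in M. (\<lambda>n. ennreal (norm (f n x - g x) powr p)) \<longlonglongrightarrow> 0"
      using lim
    proof eventually_elim
      case (elim x)
      then have "(\<lambda>n. norm (f n x - g x)) \<longlonglongrightarrow> 0" by (simp add: LIM_zero tendsto_norm_zero)
      then have "(\<lambda>n. norm (f n x - g x) powr p) \<longlonglongrightarrow> 0 powr p"
        using p by (intro tendsto_powr') auto
      then have "(\<lambda>n. ennreal (norm (f n x - g x) powr p)) \<longlonglongrightarrow> ennreal (0 powr p)"
        by (rule tendsto_ennrealI)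
      then show ?case by simp
    qed
    fix n
    have "AE x in M. \<forall>n. norm (f n x) \<le> norm (w x)" using bound by (simp add: AE_all_countable)
    then show "AE x in M. ennreal (norm (f n x - g x) powr p) \<le> ennreal (2 powr p) * ennreal (norm (w x) powr p)"
      using lim
    proof eventually_elim
      case (elim x)
      have "norm (g x) \<le> norm (w x)"
        by (rule LIMSEQ_le_const2[OF tendsto_norm[OF elim(2)]]) (use elim(1) in auto)
      then have "norm (f n x - g x) \<le> 2 * norm (w x)"
        using norm_triangle_ineq4[of "f n x" "g x"] elim(1)[rule_format, of n] by linarith
      then have "norm (f n x - g x) powr p \<le> 2 powr p * norm (w x) powr p"
        using p powr_mono2[of p "norm (f n x - g x)" "2 * norm (w x)"] by (simp add: powr_mult)
      then show ?case by (simp add: ennreal_leI flip: ennreal_mult)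
    qed
  qed measurable
  then have "eventually (\<lambda>n. (\<integral>\<^sup>+x. ennreal (norm (f n x - g x) powr p) \<partial>M) < ennreal (e powr p)) sequentially"
    using e by (intro order_tendstoD(2)[where y = 0]) auto
  then show ?thesis
  proof eventually_elim
    case (elim n)
    then have "Lp_norm (ereal p) M (\<lambda>x. f n x - g x) \<le> epowr (ennreal (e powr p)) (1 / p)"
      unfolding Lp_norm_ereal using p by (intro epowr_mono) auto
    then show ?case using p e by (simp add: powr_powr)
  qed
qed

lemma schwartz_approximable_dominated_limit:
  assumes p: "p \<ge> 1" and f: "\<And>n. schwartz_approximable p (f n)"
    and g [measurable]: "g \<in> borel_measurable borel" and wm: "w \<in> borel_measurable borel"
    and w: "(\<integral>\<^sup>+x. ennreal (norm (w x) powr p) \<partial>lborel) < \<infinity>"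
    and bound: "\<And>n. AE x in lborel. norm (f n x) \<le> norm (w x)"
    and lim: "AE x in lborel. (\<lambda>n. f n x) \<longlonglongrightarrow> g x"
  shows "schwartz_approximable p g"
  unfolding schwartz_approximable_def
proof (intro conjI allI impI)
  fix e :: real assume e: "e > 0"
  have fm [measurable]: "f n \<in> borel_measurable borel" for n
    by (rule schwartz_approximable_measurable[OF f])
  \<comment> \<open>Two errors of \<open>e / 8\<close> add up to \<open>e\<close> after the
    quasi-triangle factor 4.\<close>
  have "eventually (\<lambda>n. Lp_norm (ereal p) lborel (\<lambda>x. f n x - g x) \<le> ennreal (e / 8)) sequentially"
    by (rule Lp_norm_dominated_tendsto[OF p _ _ _ w bound lim]) (use fm g wm e in auto)
  then obtain n where n: "Lp_norm (ereal p) lborel (\<lambda>x. f n x - g x) \<le> ennreal (e / 8)"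
    by (meson eventually_happens' sequentially_bot)
  obtain F where F: "schwartz F" "Lp_norm (ereal p) lborel (\<lambda>x. F x - f n x) \<le> ennreal (e / 8)"
    using f[of n] e unfolding schwartz_approximable_def by (meson divide_pos_pos zero_less_numeral)
  have [measurable]: "F \<in> borel_measurable borel" by (rule schwartz_borel_measurable[OF F(1)])
  have "Lp_norm (ereal p) lborel (\<lambda>x. F x - g x)
      \<le> 4 * (Lp_norm (ereal p) lborel (\<lambda>x. F x - f n x) + Lp_norm (ereal p) lborel (\<lambda>x. f n x - g x))"
    using p by (intro Lp_norm_diff_triangle) auto
  also have "\<dots> \<le> 4 * (ennreal (e / 8) + ennreal (e / 8))"
    by (intro mult_left_mono add_mono F(2) n) auto
  also have "\<dots> = ennreal 4 * ennreal (e / 4)"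
    using e by (simp flip: ennreal_plus)
  also have "\<dots> = ennreal e"
    using e by (subst ennreal_mult[symmetric]) auto
  finally show "\<exists>F. schwartz F \<and> Lp_norm (ereal p) lborel (\<lambda>x. F x - g x) \<le> ennreal e"
    using F(1) by blast
qed (rule g)

lemma nn_integral_exp_norm_powr_finite:
  fixes M \<epsilon> p :: real
  assumes "\<epsilon> > 0" "p > 0"
  shows "(\<integral>\<^sup>+x. ennreal (exp (M - \<epsilon> * norm x) powr p) \<partial>(lborel :: 'a::euclidean_space measure)) < \<infinity>"
proof -
  define k where "k = DIM('a) + 2"
  define A where "A = exp (p * M) * (fact k / (p * \<epsilon>) ^ k * exp (p * \<epsilon>))"
  have A: "A \<ge> 0" using assms by (simp add: A_def)
  have "exp (M - \<epsilon> * norm x) powr p \<le> A * (1 / (1 + norm x) ^ k)" for x :: 'a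
  proof -
    have "exp (M - \<epsilon> * norm x) powr p = exp (p * M) * exp (- (p * \<epsilon> * norm x))"
      by (simp add: powr_def exp_add[symmetric] algebra_simps)
    also have "exp (- (p * \<epsilon> * norm x)) \<le> fact k / (p * \<epsilon>) ^ k * exp (p * \<epsilon>) * (1 / (1 + norm x) ^ k)"
      using power_mult_exp_bounded[of "norm x" "p * \<epsilon>" k] assms
      by (simp add: pos_le_divide_eq add_pos_nonneg mult_ac)
    finally show ?thesis by (simp add: A_def mult.assoc)
  qed
  then have "(\<integral>\<^sup>+x. ennreal (exp (M - \<epsilon> * norm x) powr p) \<partial>(lborel :: 'a measure))
      \<le> (\<integral>\<^sup>+x. ennreal A * ennreal (1 / (1 + norm x) ^ k) \<partial>(lborel :: 'a measure))"
    using A by (intro nn_integral_mono) (simp add: ennreal_leI flip: ennreal_mult)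
  also have "\<dots> = ennreal A * (\<integral>\<^sup>+x. ennreal (1 / (1 + norm x) ^ k) \<partial>(lborel :: 'a measure))"
    by (rule nn_integral_cmult) measurable
  also have "\<dots> < \<infinity>"
    using nn_integral_inverse_power_finite[where 'a = 'a] unfolding k_def[symmetric]
    by (simp add: ennreal_mult_less_top)
  finally show ?thesis .
qed

text \<open>A closed box and its open box have the same volume. The boundary has to be discarded
  because the super-Gaussians do not tend to 0 or 1 there.\<close>

lemma AE_not_in_cbox_diff_box: "AE x in lborel. x \<notin> cbox a b - box a b"
proof (rule AE_not_in)
  have "emeasure lborel (cbox a b - box a b) = emeasure lborel (cbox a b) - emeasure lborel (box a b)"
    by (rule emeasure_Diff) (auto simp: box_subset_cbox emeasure_lborel_box_eq)
  also have "\<dots> = 0"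
    by (auto simp: emeasure_lborel_box_eq emeasure_lborel_cbox_eq)
  finally show "cbox a b - box a b \<in> null_sets lborel"
    by (intro null_setsI) auto
qed

text \<open>The indicator of a box is the a.e. limit of the super-Gaussians
  \<^term>\<open>\<lambda>x. exp (- (\<Sum>i\<in>Basis. ((x \<bullet> i - c i) / r i) ^ (2 * Suc n)))\<close>.\<close>

lemma schwartz_approximable_box:
  fixes a b :: "'a::euclidean_space"
  assumes p: "p \<ge> 1"
  shows "schwartz_approximable p (\<lambda>x. indicator (box a b) x)"
proof (cases "box a b = {}")
  case True
  then show ?thesis using schwartz_approximable_schwartz[OF schwartz_zero] by simp
next
  case False
  then have ab: "a \<bullet> i < b \<bullet> i" if "i \<in> Basis" for i
    using that by (auto simp: box_ne_empty)
  define c where "c = (\<lambda>i. (a \<bullet> i + b \<bullet> i) / 2)"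
  define r where "r = (\<lambda>i. (b \<bullet> i - a \<bullet> i) / 2)"
  have r: "r i > 0" if "i \<in> Basis" for i using ab[OF that] by (simp add: r_def)
  define t where "t = (\<lambda>i x :: 'a. (x \<bullet> i - c i) / r i)"
  \<comment> \<open>The exponent is even, making \<open>P\<close> nonnegative, and positive already
    for \<open>n = 0\<close>: a constant \<open>P\<close> would give no decay.\<close>
  define P where "P = (\<lambda>(n::nat) x. \<Sum>i\<in>Basis. t i x ^ (2 * Suc n))"
  define R where "R = (\<Sum>i\<in>Basis. r i)"
  have R: "R > 0" unfolding R_def using r by (intro sum_pos) auto
  \<comment> \<open>From \<open>t^(2 * Suc n) \<ge> |t| - 1\<close> and \<open>r i \<le> R\<close>,
    summation over the basis yields \<open>norm x / R - M\<close>. Neither constant depends on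
    \<open>n\<close>, so \<open>exp (M - \<epsilon> * norm x)\<close> dominates the whole
    sequence.\<close>
  define \<epsilon> where "\<epsilon> = 1 / R"
  define M where "M = (\<Sum>i\<in>Basis. \<bar>c i\<bar>) / R + real DIM('a)"
  have poly: "real_polynomial_function (P n)" for n
    unfolding P_def t_def
    by (intro real_polynomial_function_sum real_polynomial_function_power real_polynomial_function_divide
        real_polynomial_function_diff real_polynomial_function.intros(1,2) bounded_linear_inner_left) auto
  have coercive: "P n x \<ge> \<epsilon> * norm x - M" for n x
  proof -
    have "(\<bar>x \<bullet> i\<bar> - \<bar>c i\<bar>) / R - 1 \<le> t i x ^ (2 * Suc n)" if i: "i \<in> Basis" for i
    proof -
      have "r i \<le> R" unfolding R_def using i r by (intro member_le_sum) (auto intro: less_imp_le)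
      have "(\<bar>x \<bullet> i\<bar> - \<bar>c i\<bar>) / R \<le> \<bar>x \<bullet> i - c i\<bar> / R"
        using R by (intro divide_right_mono) auto
      also have "\<dots> \<le> \<bar>x \<bullet> i - c i\<bar> / r i"
        using r[OF i] \<open>r i \<le> R\<close> by (intro divide_left_mono) auto
      also have "\<dots> = \<bar>t i x\<bar>" using r[OF i] by (simp add: t_def)
      finally have le: "(\<bar>x \<bullet> i\<bar> - \<bar>c i\<bar>) / R \<le> \<bar>t i x\<bar>" .
      have "\<bar>t i x\<bar> - 1 \<le> \<bar>t i x\<bar> ^ (2 * Suc n)"
      proof (cases "\<bar>t i x\<bar> \<le> 1")
        case True
        moreover have "0 \<le> \<bar>t i x\<bar> ^ (2 * Suc n)" by (rule zero_le_power) simp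
        ultimately show ?thesis by linarith
      next
        case False
        then have "\<bar>t i x\<bar> ^ 1 \<le> \<bar>t i x\<bar> ^ (2 * Suc n)" by (intro power_increasing) auto
        then show ?thesis by simp
      qed
      also have "\<bar>t i x\<bar> ^ (2 * Suc n) = t i x ^ (2 * Suc n)" by (rule power_even_abs) simp
      finally show ?thesis using le by linarith
    qed
    then have "(\<Sum>i\<in>Basis. (\<bar>x \<bullet> i\<bar> - \<bar>c i\<bar>) / R - 1) \<le> P n x"
      unfolding P_def by (rule sum_mono)
    moreover have "(\<Sum>i\<in>Basis. (\<bar>x \<bullet> i\<bar> - \<bar>c i\<bar>) / R - 1) = (\<Sum>i\<in>Basis. \<bar>x \<bullet> i\<bar>) / R - M"
      by (simp add: M_def sum_subtractf sum_divide_distrib diff_divide_distrib)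
    moreover have "norm x / R \<le> (\<Sum>i\<in>Basis. \<bar>x \<bullet> i\<bar>) / R"
      using R by (intro divide_right_mono norm_le_l1) auto
    ultimately show ?thesis by (simp add: \<epsilon>_def)
  qed
  have \<epsilon>: "\<epsilon> > 0" using R by (simp add: \<epsilon>_def)
  \<comment> \<open>The factor 1 is the polynomial prefactor expected by
    \<open>schwartz_polynomial_exp\<close>.\<close>
  define f where "f = (\<lambda>n x. complex_of_real (1 * exp (- P n x)))"
  have f: "schwartz_approximable p (f n)" for n
    unfolding f_def
    by (intro schwartz_approximable_schwartz schwartz_polynomial_exp[OF poly _ \<epsilon> coercive] real_polynomial_function.intros(2))
  have t_box: "(\<forall>i\<in>Basis. \<bar>t i x\<bar> < 1) \<longleftrightarrow> x \<in> box a b" "(\<forall>i\<in>Basis. \<bar>t i x\<bar> \<le> 1) \<longleftrightarrow> x \<in> cbox a b" for x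
    using r by (auto simp: mem_box t_def c_def r_def abs_if field_simps split: if_splits intro!: ball_cong)
  show ?thesis
  proof (rule schwartz_approximable_dominated_limit[OF p f])
    show "(\<lambda>x. complex_of_real (exp (M - \<epsilon> * norm x))) \<in> borel_measurable borel" by measurable
    show "(\<integral>\<^sup>+x. ennreal (norm (complex_of_real (exp (M - \<epsilon> * norm x))) powr p) \<partial>(lborel :: 'a measure)) < \<infinity>"
      using nn_integral_exp_norm_powr_finite[OF \<epsilon>, of p M] p by simp
    show "AE x in lborel. norm (f n x) \<le> norm (complex_of_real (exp (M - \<epsilon> * norm x)))" for n
      unfolding f_def using coercive[of _ n]
      by (intro AE_I2) (simp add: algebra_simps)
    show "AE x in lborel. (\<lambda>n. f n x) \<longlonglongrightarrow> indicator (box a b) x"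
      using AE_not_in_cbox_diff_box[of a b]
    proof eventually_elim
      case (elim x)
      show ?case
      proof (cases "x \<in> box a b")
        case True
        then have "\<bar>t i x\<bar> < 1" if "i \<in> Basis" for i using that t_box by blast
        then have "(\<lambda>n. P n x) \<longlonglongrightarrow> (\<Sum>i\<in>(Basis::'a set). 0)"
          unfolding P_def
        proof (intro tendsto_sum)
          fix i :: 'a assume "i \<in> Basis" "\<And>i. i \<in> Basis \<Longrightarrow> \<bar>t i x\<bar> < 1"
          then have "(\<lambda>n. t i x ^ n) \<longlonglongrightarrow> 0" by (intro LIMSEQ_power_zero) simp
          moreover have "strict_mono (\<lambda>n::nat. 2 * Suc n)" by (simp add: strict_mono_def)
          ultimately show "(\<lambda>n. t i x ^ (2 * Suc n)) \<longlonglongrightarrow> 0"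
            using LIMSEQ_subseq_LIMSEQ by (fastforce simp: o_def)
        qed
        then have "(\<lambda>n. complex_of_real (1 * exp (- P n x))) \<longlonglongrightarrow> complex_of_real (1 * exp (- 0))"
          by (intro tendsto_intros) simp
        then show ?thesis using True by (simp add: f_def)
      next
        case False
        then have "x \<notin> cbox a b" using elim by blast
        then obtain i where i: "i \<in> Basis" "\<bar>t i x\<bar> > 1" using t_box(2)[of x] by force
        have le: "t i x ^ (2 * Suc n) \<le> P n x" for n
          unfolding P_def using i(1) by (intro member_le_sum zero_le_even_power) auto
        have "filterlim (\<lambda>n. t i x ^ (2 * Suc n)) at_top sequentially"
        proof -
          have "1 < \<bar>t i x\<bar> ^ 2" using i(2) by (intro one_less_power) auto
          then have "(t i x)\<^sup>2 > 1" by simp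
          then have "filterlim (\<lambda>n. ((t i x)\<^sup>2) ^ n) at_infinity sequentially"
            by (intro filterlim_realpow_sequentially_gt1) simp
          then have "filterlim (\<lambda>n. ((t i x)\<^sup>2) ^ n) at_top sequentially"
            by (rule filterlim_at_infinity_imp_filterlim_at_top) (use i(2) in auto)
          then have "filterlim (\<lambda>n. ((t i x)\<^sup>2) ^ Suc n) at_top sequentially"
            by (rule filterlim_compose[OF _ filterlim_Suc])
          then show ?thesis by (simp only: power_mult)
        qed
        then have "filterlim (\<lambda>n. P n x) at_top sequentially"
          by (rule filterlim_at_top_mono[OF _ always_eventually[OF allI[OF le]]])
        then have "filterlim (\<lambda>n. - P n x) at_bot sequentially"
          by (rule filterlim_uminus_at_top[THEN iffD1])
        then have "(\<lambda>n. exp (- P n x)) \<longlonglongrightarrow> 0"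
          by (rule filterlim_compose[OF exp_at_bot])
        then have "(\<lambda>n. complex_of_real (1 * exp (- P n x))) \<longlonglongrightarrow> complex_of_real 0"
          by (intro tendsto_of_real) simp
        then show ?thesis using False by (simp add: f_def)
      qed
    qed
  qed measurable
qed

text \<open>Dynkin's argument on the intersection-stable family of open boxes. Everything is
  intersected with a fixed box since a Borel set or its complement may have infinite measure; inside
  the box complements stay in \<open>L^p\<close>, and the indicator of the box dominates all partial
  unions.\<close>

lemma schwartz_approximable_Int_box:
  fixes A :: "'a::euclidean_space set"
  assumes p: "p \<ge> 1" and A: "A \<in> sets borel"
  shows "schwartz_approximable p (\<lambda>x. indicator (A \<inter> box u v) x)"
proof -
  let ?W = "box u v"
  have W: "(\<integral>\<^sup>+x. ennreal (norm (indicator ?W x :: complex) powr p) \<partial>lborel) < \<infinity>"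
  proof -
    have "(\<integral>\<^sup>+x. ennreal (norm (indicator ?W x :: complex) powr p) \<partial>lborel) = (\<integral>\<^sup>+x. indicator ?W x \<partial>lborel)"
      using p by (intro nn_integral_cong) (auto split: split_indicator)
    then show ?thesis by (simp add: emeasure_lborel_box_eq)
  qed
  have "Int_stable (range (\<lambda>(a, b). box a b :: 'a set))"
    by (auto simp: Int_stable_def box_Int_box)
  moreover have "range (\<lambda>(a, b). box a b :: 'a set) \<subseteq> Pow UNIV" by simp
  moreover have "A \<in> sigma_sets UNIV (range (\<lambda>(a, b). box a b :: 'a set))"
    using A unfolding borel_eq_box by simp
  ultimately show ?thesis
  proof (induction rule: sigma_sets_induct_disjoint)
    case (basic A)
    then show ?case using schwartz_approximable_box[OF p] by (auto simp: box_Int_box)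
  next
    case empty
    then show ?case using schwartz_approximable_schwartz[OF schwartz_zero] by simp
  next
    case (compl A)
    have "schwartz_approximable p (\<lambda>x. (-1) * indicator (A \<inter> ?W) x + indicator ?W x)"
      by (intro schwartz_approximable_linear p compl schwartz_approximable_box)
    also have "(\<lambda>x. (-1) * indicator (A \<inter> ?W) x + indicator ?W x) = (\<lambda>x. indicator ((UNIV - A) \<inter> ?W) x :: complex)"
      by (auto split: split_indicator)
    finally show ?case .
  next
    case (union A)
    have A [measurable]: "A i \<in> sets borel" for i
      using union(2) unfolding borel_eq_box by auto
    define f where "f = (\<lambda>n x. \<Sum>i<n. 1 * (indicator (A i \<inter> ?W) x :: complex))"
    have f_eq: "f n x = indicator ((\<Union>i<n. A i) \<inter> ?W) x" for n x
    proof -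
      have "disjoint_family_on (\<lambda>i. A i \<inter> ?W) {..<n}"
        using union(1) by (auto simp: disjoint_family_on_def)
      then have "(\<Sum>i<n. indicator (A i \<inter> ?W) x :: complex) = indicator (\<Union>i<n. A i \<inter> ?W) x"
        by (intro indicator_UN_disjoint[symmetric]) auto
      then show ?thesis by (simp add: f_def)
    qed
    show ?case
    proof (rule schwartz_approximable_dominated_limit[OF p, of f])
      show "schwartz_approximable p (f n)" for n
        unfolding f_def by (rule schwartz_approximable_sum[OF p]) (use union(3) in auto)
      show "(\<lambda>x. indicator ?W x :: complex) \<in> borel_measurable borel" by measurable
      show "(\<lambda>x. indicator ((\<Union>i. A i) \<inter> ?W) x :: complex) \<in> borel_measurable borel" by measurable
      show "AE x in lborel. norm (f n x) \<le> norm (indicator ?W x :: complex)" for n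
        by (auto simp: f_eq split: split_indicator)
      show "AE x in lborel. (\<lambda>n. f n x) \<longlonglongrightarrow> indicator ((\<Union>i. A i) \<inter> ?W) x"
      proof (rule AE_I2)
        fix x
        show "(\<lambda>n. f n x) \<longlonglongrightarrow> indicator ((\<Union>i. A i) \<inter> ?W) x"
        proof (cases "x \<in> (\<Union>i. A i)")
          case True
          then obtain k where k: "x \<in> A k" by blast
          have "eventually (\<lambda>n. f n x = indicator ((\<Union>i. A i) \<inter> ?W) x) sequentially"
            using eventually_gt_at_top[of k]
            by eventually_elim (use k in \<open>auto simp: f_eq split: split_indicator\<close>)
          then show ?thesis by (rule tendsto_eventually)
        qed (auto simp: f_eq intro!: tendsto_eventually)
      qed
    qed (use W in auto)
  qed
qed

text \<open>Simple functions bounded by \<open>2 |f|\<close> and cut off to growing boxes converge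
  to \<open>f\<close> pointwise, and each is a finite combination of indicators of Borel sets inside
  a box.\<close>

lemma schwartz_approximable_Lp_space:
  fixes f :: "'a::euclidean_space \<Rightarrow> complex"
  assumes p: "p \<ge> 1" and f: "f \<in> Lp_space (ereal p) lborel"
  shows "schwartz_approximable p f"
proof -
  have mf [measurable]: "f \<in> borel_measurable borel" using f by (simp add: Lp_space_def)
  have fin: "(\<integral>\<^sup>+x. ennreal (norm (f x) powr p) \<partial>lborel) < \<infinity>"
    using f by (auto simp: Lp_space_def Lp_norm_ereal epowr_less_top_iff[unfolded infinity_ennreal_def])
  obtain s where s: "\<And>i. simple_function lborel (s i)" "\<And>x. (\<lambda>i. s i x) \<longlonglongrightarrow> f x"
    "\<And>i x. norm (s i x) \<le> 2 * norm (f x)"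
    using borel_measurable_implies_sequence_metric[of f lborel 0] by (auto simp: dist_norm)
  have [measurable]: "s i \<in> borel_measurable borel" for i
    using borel_measurable_simple_function[OF s(1)[of i]] by simp
  define W :: "nat \<Rightarrow> 'a set" where "W = (\<lambda>n. box (- (real n *\<^sub>R One)) (real n *\<^sub>R One))"
  \<comment> \<open>This is \<open>s n\<close> cut off to \<open>W n\<close>, spelled out by its
    values to fit \<open>schwartz_approximable_sum\<close>.\<close>
  define g where "g = (\<lambda>n x. \<Sum>y\<in>range (s n). y * indicator (s n -` {y} \<inter> W n) x)"
  have g_eq: "g n x = s n x * indicator (W n) x" for n x
  proof -
    have "finite (range (s n))" using s(1)[of n] by (simp add: simple_function_def)
    moreover have "g n x = (\<Sum>y\<in>range (s n). if y = s n x then s n x * indicator (W n) x else 0)"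
      unfolding g_def by (intro sum.cong) (auto split: split_indicator)
    ultimately show ?thesis by simp
  qed
  show ?thesis
  proof (rule schwartz_approximable_dominated_limit[OF p, of g])
    show "schwartz_approximable p (g n)" for n
      unfolding g_def
    proof (rule schwartz_approximable_sum[OF p])
      show "finite (range (s n))" using s(1)[of n] by (simp add: simple_function_def)
      fix y
      have "s n -` {y} \<in> sets borel"
        using measurable_sets[of "s n" borel borel "{y}"] by simp
      then show "schwartz_approximable p (\<lambda>x. indicator (s n -` {y} \<inter> W n) x)"
        unfolding W_def by (rule schwartz_approximable_Int_box[OF p])
    qed
    show "(\<lambda>x. 2 * f x) \<in> borel_measurable borel" by measurable
    have "(\<integral>\<^sup>+x. ennreal (norm (2 * f x) powr p) \<partial>lborel) = ennreal (2 powr p) * (\<integral>\<^sup>+x. ennreal (norm (f x) powr p) \<partial>lborel)"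
      by (simp add: norm_mult powr_mult ennreal_mult nn_integral_cmult)
    then show "(\<integral>\<^sup>+x. ennreal (norm (2 * f x) powr p) \<partial>lborel) < \<infinity>"
      using fin by (simp add: ennreal_mult_less_top)
    show "AE x in lborel. norm (g n x) \<le> norm (2 * f x)" for n
      using s(3)[of n] by (auto simp: g_eq norm_mult split: split_indicator)
    show "AE x in lborel. (\<lambda>n. g n x) \<longlonglongrightarrow> f x"
    proof (rule AE_I2)
      fix x :: 'a
      obtain k where k: "norm x < real k" using reals_Archimedean2 by blast
      have "eventually (\<lambda>n. s n x = g n x) sequentially"
        using eventually_ge_at_top[of k]
      proof eventually_elim
        case (elim n)
        have "x \<in> W n"
          unfolding W_def mem_box
        proof
          fix i :: 'a assume "i \<in> Basis"
          then show "- (real n *\<^sub>R One) \<bullet> i < x \<bullet> i \<and> x \<bullet> i < real n *\<^sub>R One \<bullet> i"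
            using Basis_le_norm[of i x] k elim by (auto simp: abs_le_iff)
        qed
        then show ?case by (simp add: g_eq)
      qed
      then show "(\<lambda>n. g n x) \<longlonglongrightarrow> f x" using s(2)[of x] by (rule Lim_transform_eventually[rotated])
    qed
  qed (rule mf)
qed

section \<open>Completeness and the extension by density\<close>

text \<open>Geometric decay replaces the choice of a subsequence: on a finite measure space the
  consecutive differences are summable in \<open>L^1\<close>, so the telescoping series converges
  a.e., and Fatou's lemma turns the a.e. limit into an \<open>L^2\<close> limit.\<close>

lemma (in finite_measure) Lp_norm_2_complete:
  fixes g :: "nat \<Rightarrow> 'a \<Rightarrow> complex"
  assumes [measurable]: "\<And>n. g n \<in> borel_measurable M" and K: "K \<ge> 0"
    and cauchy: "\<And>n m. Lp_norm (ereal 2) M (\<lambda>x. g n x - g m x) \<le> ennreal (K * (1 / 2 ^ n + 1 / 2 ^ m))"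
  shows "\<exists>G\<in>borel_measurable M. (\<lambda>n. Lp_norm (ereal 2) M (\<lambda>x. g n x - G x)) \<longlonglongrightarrow> 0"
proof -
  obtain B where B: "B > 0" "epowr (emeasure M (space M)) (1 / 2) \<le> ennreal B"
    using exists_ennreal_bound[OF epowr_emeasure_less_top] by blast
  have step: "(\<integral>\<^sup>+x. ennreal (norm (g (Suc n) x - g n x)) \<partial>M) \<le> ennreal (B * K * 2 * (1 / 2) ^ n)" for n
  proof -
    have "(\<integral>\<^sup>+x. ennreal (norm (g (Suc n) x - g n x)) \<partial>M)
        \<le> epowr (emeasure M (space M)) (1 / 2) * Lp_norm (ereal 2) M (\<lambda>x. g (Suc n) x - g n x)"
      using nn_integral_norm_le_Lp_norm_2[of "\<lambda>x. g (Suc n) x - g n x"] by simp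
    also have "\<dots> \<le> ennreal B * ennreal (K * (1 / 2 ^ Suc n + 1 / 2 ^ n))"
      by (intro mult_mono B(2) cauchy) auto
    also have "\<dots> = ennreal (B * (K * (1 / 2 ^ Suc n + 1 / 2 ^ n)))"
      using B K by (intro ennreal_mult[symmetric]) auto
    also have "\<dots> \<le> ennreal (B * K * 2 * (1 / 2) ^ n)"
    proof (rule ennreal_leI)
      have "1 / 2 ^ Suc n + 1 / 2 ^ n \<le> (2 * (1 / 2) ^ n :: real)"
        by (simp add: power_one_over field_simps)
      then have "(B * K) * (1 / 2 ^ Suc n + 1 / 2 ^ n) \<le> (B * K) * (2 * (1 / 2) ^ n)"
        using B K by (intro mult_left_mono) auto
      then show "B * (K * (1 / 2 ^ Suc n + 1 / 2 ^ n)) \<le> B * K * 2 * (1 / 2) ^ n"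
        by (simp only: mult.assoc)
    qed
    finally show ?thesis .
  qed
  have "(\<integral>\<^sup>+x. (\<Sum>n. ennreal (norm (g (Suc n) x - g n x))) \<partial>M)
      = (\<Sum>n. \<integral>\<^sup>+x. ennreal (norm (g (Suc n) x - g n x)) \<partial>M)"
    by (rule nn_integral_suminf) measurable
  also have "\<dots> \<le> (\<Sum>n. ennreal (B * K * 2 * (1 / 2) ^ n))"
    by (intro suminf_le step) auto
  also have "\<dots> = ennreal (\<Sum>n. B * K * 2 * (1 / 2) ^ n)"
    using B K by (intro suminf_ennreal2 summable_mult summable_geometric) auto
  finally have "(\<integral>\<^sup>+x. (\<Sum>n. ennreal (norm (g (Suc n) x - g n x))) \<partial>M) \<noteq> \<infinity>"
    by (auto simp: top_unique)
  then have "AE x in M. (\<Sum>n. ennreal (norm (g (Suc n) x - g n x))) \<noteq> \<infinity>"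
    by (intro nn_integral_noteq_infinite) auto
  then have lim: "AE x in M. (\<lambda>n. g n x) \<longlonglongrightarrow> lim (\<lambda>n. g n x)"
  proof eventually_elim
    case (elim x)
    then have "summable (\<lambda>n. norm (g (Suc n) x - g n x))"
      by (intro summable_suminf_not_top) auto
    then have "summable (\<lambda>n. g (Suc n) x - g n x)" by (rule summable_norm_cancel)
    then have "convergent (\<lambda>n. \<Sum>i<n. g (Suc i) x - g i x)" by (rule summable_iff_convergent[THEN iffD1])
    then have "convergent (\<lambda>n. g n x - g 0 x)" by (simp add: sum_lessThan_telescope[of "\<lambda>n. g n x"])
    then have "convergent (\<lambda>n. (g n x - g 0 x) + g 0 x)" by (intro convergent_add convergent_const)
    then show ?case by (simp add: convergent_LIMSEQ_iff)
  qed
  define G where "G = (\<lambda>x. lim (\<lambda>n. g n x))"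
  have [measurable]: "G \<in> borel_measurable M" unfolding G_def by measurable
  have sq: "(\<integral>\<^sup>+x. ennreal ((norm (h x))\<^sup>2) \<partial>M) = epowr (Lp_norm (ereal 2) M h) 2" for h
    unfolding Lp_norm_ereal by (simp add: epowr_epowr)
  have le: "Lp_norm (ereal 2) M (\<lambda>x. g n x - G x) \<le> ennreal (2 * K * (1 / 2) ^ n)" for n
  proof -
    \<comment> \<open>Fatou in the second index \<open>m\<close>: a.e. the integrand is the limit,
      hence the liminf, of the squared differences.\<close>
    have "(\<integral>\<^sup>+x. ennreal ((norm (g n x - G x))\<^sup>2) \<partial>M) = (\<integral>\<^sup>+x. liminf (\<lambda>m. ennreal ((norm (g n x - g m x))\<^sup>2)) \<partial>M)"
    proof (rule nn_integral_cong_AE)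
      show "AE x in M. ennreal ((norm (g n x - G x))\<^sup>2) = liminf (\<lambda>m. ennreal ((norm (g n x - g m x))\<^sup>2))"
        using lim
      proof eventually_elim
        case (elim x)
        then have "(\<lambda>m. ennreal ((norm (g n x - g m x))\<^sup>2)) \<longlonglongrightarrow> ennreal ((norm (g n x - G x))\<^sup>2)"
          unfolding G_def by (intro tendsto_ennrealI tendsto_intros)
        then show ?case by (metis lim_imp_Liminf sequentially_bot trivial_limit_sequentially)
      qed
    qed
    also have "\<dots> \<le> liminf (\<lambda>m. \<integral>\<^sup>+x. ennreal ((norm (g n x - g m x))\<^sup>2) \<partial>M)"
      by (rule nn_integral_liminf) measurable
    also have "\<dots> \<le> liminf (\<lambda>m :: nat. epowr (ennreal (2 * K * (1 / 2) ^ n)) 2)"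
    proof (rule Liminf_mono)
      show "\<forall>\<^sub>F m in sequentially. (\<integral>\<^sup>+x. ennreal ((norm (g n x - g m x))\<^sup>2) \<partial>M) \<le> epowr (ennreal (2 * K * (1 / 2) ^ n)) 2"
        using eventually_ge_at_top[of n]
      proof eventually_elim
        case (elim m)
        have "1 / 2 ^ m \<le> (1 / 2 ^ n :: real)" using elim by (intro divide_left_mono power_increasing) auto
        then have "K * (1 / 2 ^ n + 1 / 2 ^ m) \<le> K * (2 * (1 / 2) ^ n)"
          using K by (intro mult_left_mono) (auto simp: power_one_over)
        then have "Lp_norm (ereal 2) M (\<lambda>x. g n x - g m x) \<le> ennreal (2 * K * (1 / 2) ^ n)"
          by (intro order_trans[OF cauchy] ennreal_leI) (simp add: mult_ac)
        then show ?case unfolding sq by (intro epowr_mono) auto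
      qed
    qed
    also have "\<dots> = epowr (ennreal (2 * K * (1 / 2) ^ n)) 2" by (simp add: Liminf_const)
    finally have "epowr (\<integral>\<^sup>+x. ennreal ((norm (g n x - G x))\<^sup>2) \<partial>M) (1 / 2) \<le> epowr (epowr (ennreal (2 * K * (1 / 2) ^ n)) 2) (1 / 2)"
      by (intro epowr_mono) auto
    then show ?thesis by (simp add: epowr_epowr Lp_norm_ereal)
  qed
  have lim0: "(\<lambda>n. ennreal (2 * K * (1 / 2) ^ n)) \<longlonglongrightarrow> ennreal (2 * K * 0)"
    by (intro tendsto_ennrealI tendsto_intros LIMSEQ_power_zero) auto
  have "(\<lambda>n. Lp_norm (ereal 2) M (\<lambda>x. g n x - G x)) \<longlonglongrightarrow> 0"
  proof (rule tendsto_sandwich[of "\<lambda>_. 0" _ _ "\<lambda>n. ennreal (2 * K * (1 / 2) ^ n)"])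
    show "\<forall>\<^sub>F n in sequentially. Lp_norm (ereal 2) M (\<lambda>x. g n x - G x) \<le> ennreal (2 * K * (1 / 2) ^ n)"
      using le by (rule always_eventually[OF allI])
    show "(\<lambda>n. ennreal (2 * K * (1 / 2) ^ n)) \<longlonglongrightarrow> 0" using lim0 by simp
    show "\<forall>\<^sub>F n in sequentially. 0 \<le> Lp_norm (ereal 2) M (\<lambda>x. g n x - G x)" by simp
  qed simp
  then show ?thesis by (intro bexI[of _ G]) auto
qed

text \<open>Schwartz approximations with error \<open>1 / 2 ^ n\<close> are compared through
  \<open>f\<close>, and the restriction bound carries their geometric Cauchy estimate over to the
  transforms in \<open>L^2(\<mu>)\<close>. The limit is in \<open>L^2(\<mu>)\<close> because it is
  close to one of these transforms.\<close>

lemma fourier_extension_exists: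
  fixes \<mu> :: "'a::euclidean_space measure"
  assumes sets: "sets \<mu> = sets borel" and "finite_measure \<mu>" and p: "p \<ge> 1" and C: "C > 0"
    and bound: "\<And>h. integrable lborel h \<Longrightarrow>
      Lp_norm 2 \<mu> (fourier lborel h) \<le> ennreal C * Lp_norm (ereal p) lborel h"
    and f: "f \<in> Lp_space (ereal p) lborel"
  shows "\<exists>g. fourier_extension \<mu> (ereal p) f g"
proof -
  interpret finite_measure \<mu> by fact
  note sets[measurable_cong]
  have [measurable]: "f \<in> borel_measurable borel" using f by (simp add: Lp_space_def)
  have "\<exists>F. schwartz F \<and> Lp_norm (ereal p) lborel (\<lambda>x. F x - f x) \<le> ennreal (1 / 2 ^ n)" for n :: nat
    using schwartz_approximable_Lp_space[OF p f] unfolding schwartz_approximable_def by simp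
  then obtain F where F: "\<And>n. schwartz (F n)"
    "\<And>n. Lp_norm (ereal p) lborel (\<lambda>x. F n x - f x) \<le> ennreal (1 / 2 ^ n)"
    by metis
  have Fm [measurable]: "F n \<in> borel_measurable borel" for n by (rule schwartz_borel_measurable[OF F(1)])
  have Fi: "integrable lborel (F n)" for n by (rule schwartz_integrable[OF F(1)])
  define g where "g = (\<lambda>n. fourier lborel (F n))"
  have [measurable]: "g n \<in> borel_measurable borel" for n
    unfolding g_def by (rule borel_measurable_fourier) (auto intro: sigma_finite_lborel)
  have cauchy: "Lp_norm (ereal 2) \<mu> (\<lambda>x. g n x - g m x) \<le> ennreal (4 * C * (1 / 2 ^ n + 1 / 2 ^ m))" for n m
  proof -
    have "Lp_norm (ereal 2) \<mu> (\<lambda>x. g n x - g m x) = Lp_norm 2 \<mu> (fourier lborel (\<lambda>x. F n x - F m x))"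
    proof -
      have "(\<lambda>x. g n x - g m x) = fourier lborel (\<lambda>x. F n x - F m x)"
        unfolding g_def by (rule ext, rule fourier_diff[OF _ Fi Fi, symmetric]) simp
      then show ?thesis by simp
    qed
    also have "\<dots> \<le> ennreal C * Lp_norm (ereal p) lborel (\<lambda>x. F n x - F m x)"
      by (intro bound Bochner_Integration.integrable_diff Fi)
    also have "\<dots> \<le> ennreal C * (4 * (Lp_norm (ereal p) lborel (\<lambda>x. F n x - f x) + Lp_norm (ereal p) lborel (\<lambda>x. f x - F m x)))"
      using p by (intro mult_left_mono Lp_norm_diff_triangle) auto
    also have "Lp_norm (ereal p) lborel (\<lambda>x. f x - F m x) = Lp_norm (ereal p) lborel (\<lambda>x. F m x - f x)"
      by (rule Lp_norm_minus_commute)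
    also have "ennreal C * (4 * (Lp_norm (ereal p) lborel (\<lambda>x. F n x - f x) + Lp_norm (ereal p) lborel (\<lambda>x. F m x - f x)))
      \<le> ennreal C * (4 * (ennreal (1 / 2 ^ n) + ennreal (1 / 2 ^ m)))"
      by (intro mult_left_mono add_mono F) auto
    also have "\<dots> = ennreal C * (ennreal 4 * ennreal (1 / 2 ^ n + 1 / 2 ^ m))"
      by (subst ennreal_plus) auto
    also have "\<dots> = ennreal (C * (4 * (1 / 2 ^ n + 1 / 2 ^ m)))"
      using C by (subst ennreal_mult[symmetric], simp, simp, subst ennreal_mult[symmetric]) auto
    finally show ?thesis by (simp only: mult_ac)
  qed
  have "\<exists>G\<in>borel_measurable \<mu>. (\<lambda>n. Lp_norm (ereal 2) \<mu> (\<lambda>x. g n x - G x)) \<longlonglongrightarrow> 0"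
    by (rule Lp_norm_2_complete[OF _ _ cauchy]) (use C in auto)
  then obtain G where G [measurable]: "G \<in> borel_measurable \<mu>"
    and lim: "(\<lambda>n. Lp_norm (ereal 2) \<mu> (\<lambda>x. g n x - G x)) \<longlonglongrightarrow> 0" by blast
  have "eventually (\<lambda>n. Lp_norm (ereal 2) \<mu> (\<lambda>x. g n x - G x) < 1) sequentially"
    using lim by (rule order_tendstoD) simp
  then obtain n where n: "Lp_norm (ereal 2) \<mu> (\<lambda>x. g n x - G x) < 1"
    by (meson eventually_happens' sequentially_bot)
  have fin: "Lp_norm (ereal 2) \<mu> (g n) < \<infinity>"
  proof -
    have "Lp_norm (ereal p) lborel (F n) \<le> 4 * (Lp_norm (ereal p) lborel (\<lambda>x. F n x - f x) + Lp_norm (ereal p) lborel f)"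
      using p by (intro Lp_norm_le_diff) auto
    also have "\<dots> < \<infinity>"
      using f order_le_less_trans[OF F(2)[of n] ennreal_less_top]
      by (auto simp: Lp_space_def ennreal_mult_less_top)
    finally have "ennreal C * Lp_norm (ereal p) lborel (F n) < \<infinity>"
      by (simp add: ennreal_mult_less_top)
    then show ?thesis using bound[OF Fi[of n]] by (auto simp: g_def intro: order_le_less_trans)
  qed
  have "Lp_norm (ereal 2) \<mu> G \<le> 4 * (Lp_norm (ereal 2) \<mu> (\<lambda>x. G x - g n x) + Lp_norm (ereal 2) \<mu> (g n))"
    by (rule Lp_norm_le_diff) auto
  also have "Lp_norm (ereal 2) \<mu> (\<lambda>x. G x - g n x) = Lp_norm (ereal 2) \<mu> (\<lambda>x. g n x - G x)"
    by (rule Lp_norm_minus_commute)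
  also have "4 * (\<dots> + Lp_norm (ereal 2) \<mu> (g n)) < \<infinity>"
    using fin order_less_trans[OF n, of \<infinity>] by (simp add: ennreal_mult_less_top)
  finally have "G \<in> Lp_space 2 \<mu>" by (simp add: Lp_space_def)
  moreover have "(\<lambda>n. Lp_norm (ereal p) lborel (\<lambda>x. F n x - f x)) \<longlonglongrightarrow> 0"
  proof (rule tendsto_sandwich[of "\<lambda>_. 0" _ _ "\<lambda>n. ennreal (1 / 2 ^ n)"])
    have "(\<lambda>n. ennreal ((1 / 2) ^ n)) \<longlonglongrightarrow> ennreal 0"
      by (intro tendsto_ennrealI LIMSEQ_power_zero) auto
    then show "(\<lambda>n. ennreal (1 / 2 ^ n)) \<longlonglongrightarrow> 0" by (simp add: power_one_over)
  qed (use F(2) in auto)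
  ultimately show ?thesis
    using lim F(1) unfolding fourier_extension_def g_def by auto
qed

text \<open>The bound for the Schwartz approximations passes to the limit. The quasi-triangle
  inequality is used once in \<open>L^2(\<mu>)\<close> and once in \<open>L^p\<close>, whence
  \<open>16 = 4 * 4\<close>. Any \<open>g\<close> with some approximating sequence is covered, so
  the choice of sequence is immaterial.\<close>

lemma fourier_extension_norm_le:
  fixes \<mu> :: "'a::euclidean_space measure"
  assumes sets: "sets \<mu> = sets borel" and p: "p \<ge> 1"
    and bound: "\<And>h. integrable lborel h \<Longrightarrow>
      Lp_norm 2 \<mu> (fourier lborel h) \<le> ennreal C * Lp_norm (ereal p) lborel h"
    and f: "f \<in> Lp_space (ereal p) lborel" and g: "fourier_extension \<mu> (ereal p) f g"
  shows "Lp_norm 2 \<mu> g \<le> 16 * ennreal C * Lp_norm (ereal p) lborel f"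
proof -
  note sets[measurable_cong]
  have [measurable]: "f \<in> borel_measurable borel" "g \<in> borel_measurable \<mu>"
    using f g by (simp_all add: Lp_space_def fourier_extension_def)
  obtain F where F: "\<And>n. schwartz (F n)"
    "(\<lambda>n. Lp_norm (ereal p) lborel (\<lambda>x. F n x - f x)) \<longlonglongrightarrow> 0"
    "(\<lambda>n. Lp_norm 2 \<mu> (\<lambda>\<xi>. fourier lborel (F n) \<xi> - g \<xi>)) \<longlonglongrightarrow> 0"
    using g by (auto simp: fourier_extension_def)
  have [measurable]: "F n \<in> borel_measurable borel" for n by (rule schwartz_borel_measurable[OF F(1)])
  have [measurable]: "fourier lborel (F n) \<in> borel_measurable borel" for n
    by (rule borel_measurable_fourier) (auto intro: sigma_finite_lborel)
  let ?N = "Lp_norm (ereal p) lborel"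
  have le: "Lp_norm 2 \<mu> g \<le> 4 * (Lp_norm 2 \<mu> (\<lambda>\<xi>. fourier lborel (F n) \<xi> - g \<xi>)
      + ennreal C * (4 * (?N (\<lambda>x. F n x - f x) + ?N f)))" for n
  proof -
    have "Lp_norm (ereal 2) \<mu> g \<le> 4 * (Lp_norm (ereal 2) \<mu> (\<lambda>\<xi>. g \<xi> - fourier lborel (F n) \<xi>) + Lp_norm (ereal 2) \<mu> (fourier lborel (F n)))"
      by (rule Lp_norm_le_diff) auto
    also have "Lp_norm (ereal 2) \<mu> (\<lambda>\<xi>. g \<xi> - fourier lborel (F n) \<xi>) = Lp_norm (ereal 2) \<mu> (\<lambda>\<xi>. fourier lborel (F n) \<xi> - g \<xi>)"
      by (rule Lp_norm_minus_commute)
    also have "Lp_norm (ereal 2) \<mu> (fourier lborel (F n)) \<le> ennreal C * ?N (F n)"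
      using bound[OF schwartz_integrable[OF F(1)[of n]]] by simp
    also have "?N (F n) \<le> 4 * (?N (\<lambda>x. F n x - f x) + ?N f)"
      using p by (intro Lp_norm_le_diff) auto
    finally show ?thesis by (simp add: mult_left_mono)
  qed
  have "(\<lambda>n. 4 * (Lp_norm 2 \<mu> (\<lambda>\<xi>. fourier lborel (F n) \<xi> - g \<xi>)
      + ennreal C * (4 * (?N (\<lambda>x. F n x - f x) + ?N f)))) \<longlonglongrightarrow> 4 * (0 + ennreal C * (4 * (0 + ?N f)))"
    by (intro ennreal_tendsto_cmult tendsto_add F(2,3) tendsto_const) auto
  then have "Lp_norm 2 \<mu> g \<le> 4 * (0 + ennreal C * (4 * (0 + ?N f)))"
    by (rule LIMSEQ_le_const) (use le in blast)
  also have "\<dots> = (4 * 4) * ennreal C * ?N f" by (simp only: add_0 mult_ac)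
  finally show ?thesis by simp
qed

theorem corollary3p4:
  fixes \<mu> :: "'a::euclidean_space measure"
  assumes "sets \<mu> = sets borel"
    and "finite_measure \<mu>"
    and "emeasure \<mu> UNIV \<noteq> 0"
    and "compact (measure_support \<mu>)"
  shows
    "(\<forall>q::ereal. q > (INF \<theta>\<in>admissible \<mu>. 4 / ereal \<theta>) \<longrightarrow>
        (\<exists>C::real. C > 0 \<and>
          (\<forall>f\<in>Lp_space 2 \<mu>. Lp_norm q lborel (fourier \<mu> f) \<le> ennreal C * Lp_norm 2 \<mu> f)))
     \<and>
     (\<forall>q'::real. 1 \<le> q' \<and> ereal q' < (SUP \<theta>\<in>admissible \<mu>. ereal (4 / (4 - \<theta>))) \<longrightarrow>
        (\<exists>C::real. C > 0 \<and>
          (\<forall>f. schwartz f \<longrightarrow>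
             Lp_norm 2 \<mu> (fourier lborel f) \<le> ennreal C * Lp_norm q' lborel f) \<and>
          (\<forall>f\<in>Lp_space q' lborel.
             (\<exists>g. fourier_extension \<mu> q' f g) \<and>
             (\<forall>g. fourier_extension \<mu> q' f g \<longrightarrow>
                Lp_norm 2 \<mu> g \<le> ennreal C * Lp_norm q' lborel f))))"
proof (intro conjI allI impI)
  fix q :: ereal
  assume "q > (INF \<theta>\<in>admissible \<mu>. 4 / ereal \<theta>)"
  then show "\<exists>C>0. \<forall>f\<in>Lp_space 2 \<mu>. Lp_norm q lborel (fourier \<mu> f) \<le> ennreal C * Lp_norm 2 \<mu> f"
    by (rule fourier_extension_bound[OF assms(1,2)])
next
  fix q' :: real
  assume "1 \<le> q' \<and> ereal q' < (SUP \<theta>\<in>admissible \<mu>. ereal (4 / (4 - \<theta>)))"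
  then have q': "1 \<le> q'" "ereal q' < (SUP \<theta>\<in>admissible \<mu>. ereal (4 / (4 - \<theta>)))" by auto
  obtain C where C: "C > 0" and bound: "\<And>h. integrable lborel h \<Longrightarrow>
      Lp_norm 2 \<mu> (fourier lborel h) \<le> ennreal C * Lp_norm (ereal q') lborel h"
    using fourier_restriction_bound[OF assms(1,2) q'] by blast
  have C16: "16 * ennreal C = ennreal (16 * C)" "C \<le> 16 * C" using C by (simp_all add: ennreal_mult)
  show "\<exists>C>0. (\<forall>f. schwartz f \<longrightarrow> Lp_norm 2 \<mu> (fourier lborel f) \<le> ennreal C * Lp_norm q' lborel f) \<and>
      (\<forall>f\<in>Lp_space q' lborel. (\<exists>g. fourier_extension \<mu> q' f g) \<and>
        (\<forall>g. fourier_extension \<mu> q' f g \<longrightarrow> Lp_norm 2 \<mu> g \<le> ennreal C * Lp_norm q' lborel f))"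
  \<comment> \<open>One constant has to serve both clauses: Schwartz functions need only
    \<open>C\<close>, the extension by density needs \<open>16 * C\<close>.\<close>
  proof (intro exI[of _ "16 * C"] conjI allI impI ballI)
    show "Lp_norm 2 \<mu> (fourier lborel f) \<le> ennreal (16 * C) * Lp_norm q' lborel f" if "schwartz f" for f
      using order_trans[OF bound[OF schwartz_integrable[OF that]] mult_right_mono[OF ennreal_leI[OF C16(2)]]]
      by simp
    show "\<exists>g. fourier_extension \<mu> q' f g" if "f \<in> Lp_space q' lborel" for f
      by (rule fourier_extension_exists[OF assms(1,2) q'(1) C bound that])
    show "Lp_norm 2 \<mu> g \<le> ennreal (16 * C) * Lp_norm q' lborel f"
      if "f \<in> Lp_space q' lborel" "fourier_extension \<mu> q' f g" for f g
      using fourier_extension_norm_le[OF assms(1) q'(1) bound that] unfolding C16 .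
  qed (use C in simp)
qed

end
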